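(* Let $k$ be an algebraically closed field, let $Q$ be a finite quiver with vertices $1,\dots,n$ such that there are no arrows $i\to j$ when $i$ is strictly smaller than $j$, and let $A=kQ/I$ with $I$ an admissible ideal. Let $B$ be a subalgebra of $A$ conjugate to a subalgebra of $A$ generated as a subalgebra by the elements (vertices and arrows) of a quiver $R$, whose vertices and arrows are elements of $A$, satisfying the following properties: \begin{itemize} \item the vertices of $R$ are sums of vertices of $Q$; \item the arrows $\beta$ of $R$ are such that $\beta=f\beta e$, where $e,f$ are vertices of $Q$; \item $R$ contains every loop of $Q$. \end{itemize} Then $\mathrm{gldim}(A,B)\leq n-1$.
   Context: Algebras are associative and unital, subalgebras are unital, modules are left modules. Vertices of $Q$ are identified with the corresponding idempotents, paths are composed from right to left (an arrow $\alpha$ from $e$ to $f$ satisfies $\alpha=f\alpha e$), and vertices, arrows and paths of $Q$ are identified with their images in $A=kQ/I$. An arrow $\beta$ of $R$ from the vertex $x$ to the vertex $y$ of $R$ satisfies $\beta=y\beta x$ in $A$. Two subalgebras $B,C$ of $A$ are conjugate if $C=\{zbz^{-1}\mid b\in B\}$ for some unit $z$ of $A$. Relative notions. Let $B\subseteq A$ be an extension of algebras. An $A$-module is $(A,B)$-projective if it is isomorphic to a direct summand of $A\otimes_B V$ for some $B$-module $V$. An exact sequence of $A$-modules $\cdots\to M_{n+1}\to M_n\to M_{n-1}\to 0$ is $(A,B)$-exact if the kernel of each map $M_i\to M_{i-1}$, $i\geq n$, is a direct summand of $M_i$ as a $B$-module. The relative projective dimension $\mathrm{pd}_{(A,B)}M$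 of an $A$-module $M$ is the least $n$ for which there is an $(A,B)$-exact sequence $0\to P_n\to\cdots\to P_0\to M\to 0$ with all $P_i$ $(A,B)$-projective (and $\infty$ if none exists). The left relative global dimension $\mathrm{gldim}(A,B)$ is the supremum of the relative projective dimensions of all left $A$-modules. *)

theory Defs
  imports
    "HOL-Computational_Algebra.Polynomial"
    "HOL-Library.Extended_Nat"
    "HOL-Algebra.Free_Abelian_Groups"
    "HOL-Algebra.QuotRing"
    "HOL-Algebra.Ideal_Product"
    "HOL-Algebra.Embedded_Algebras"
    "Graph_Theory.Arc_Walk"
begin

section \<open>Path algebras\<close>

text \<open>
  A quiver is a \<^typ>\<open>('v, 'e) pre_digraph\<close>; an arrow \<open>a\<close> goes from \<open>tail Q a\<close> to \<open>head Q a\<close>.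
  The path \<open>(u, [a\<^sub>1, \<dots>, a\<^sub>l], v)\<close> starts at \<open>u\<close>, traverses \<open>a\<^sub>1\<close> first, and ends at \<open>v\<close>;
  \<open>(v, [], v)\<close> is the trivial path at \<open>v\<close>.
\<close>

type_synonym ('v, 'e) qpath = "'v \<times> 'e list \<times> 'v"

definition qpaths :: "('v, 'e) pre_digraph \<Rightarrow> ('v, 'e) qpath set" where
  "qpaths Q = {(u, p, v). pre_digraph.awalk Q u p v}"

text \<open>
  Paths are composed from right to left: in \<open>path_mult f g\<close> the paths of \<open>g\<close> are traversed first.
\<close>

definition path_mult ::
  "(('v, 'e) qpath \<Rightarrow>\<^sub>0 'k::comm_ring_1) \<Rightarrow> (('v, 'e) qpath \<Rightarrow>\<^sub>0 'k) \<Rightarrow> (('v, 'e) qpath \<Rightarrow>\<^sub>0 'k)" where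
  "path_mult f g =
    (\<Sum>(v', bs, w)\<in>Poly_Mapping.keys f. \<Sum>(u, as, v)\<in>Poly_Mapping.keys g.
       if v = v'
       then Poly_Mapping.single (u, as @ bs, w)
              (Poly_Mapping.lookup f (v', bs, w) * Poly_Mapping.lookup g (u, as, v))
       else 0)"

definition path_algebra :: "('v, 'e) pre_digraph \<Rightarrow> (('v, 'e) qpath \<Rightarrow>\<^sub>0 'k::comm_ring_1) ring" where
  "path_algebra Q =
    \<lparr> carrier = {f. Poly_Mapping.keys f \<subseteq> qpaths Q},
      mult = path_mult,
      one = (\<Sum>v\<in>verts Q. Poly_Mapping.single (v, [], v) 1),
      zero = 0,
      add = (+) \<rparr>"

definition path_vertex :: "'v \<Rightarrow> (('v, 'e) qpath \<Rightarrow>\<^sub>0 'k::comm_ring_1)" where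
  "path_vertex v = Poly_Mapping.single (v, [], v) 1"

definition path_arrow :: "('v, 'e) pre_digraph \<Rightarrow> 'e \<Rightarrow> (('v, 'e) qpath \<Rightarrow>\<^sub>0 'k::comm_ring_1)" where
  "path_arrow Q a = Poly_Mapping.single (tail Q a, [a], head Q a) 1"

definition arrow_ideal :: "('v, 'e) pre_digraph \<Rightarrow> (('v, 'e) qpath \<Rightarrow>\<^sub>0 'k::comm_ring_1) set" where
  "arrow_ideal Q = Idl\<^bsub>path_algebra Q\<^esub> (path_arrow Q ` arcs Q)"

text \<open>
  \<^const>\<open>ideals_set\<close> is the structure of two-sided ideals under the ideal product, so the powers
  below are powers of the arrow ideal.
\<close>

definition admissible_ideal ::
  "('v, 'e) pre_digraph \<Rightarrow> (('v, 'e) qpath \<Rightarrow>\<^sub>0 'k::comm_ring_1) set \<Rightarrow> bool" where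
  "admissible_ideal Q I \<longleftrightarrow>
    ideal I (path_algebra Q) \<and>
    I \<subseteq> arrow_ideal Q [^]\<^bsub>ideals_set (path_algebra Q)\<^esub> (2::nat) \<and>
    (\<exists>m\<ge>2. arrow_ideal Q [^]\<^bsub>ideals_set (path_algebra Q)\<^esub> (m::nat) \<subseteq> I)"

text \<open>Images of vertices, arrows and scalars in \<open>path_algebra Q Quot I\<close>.\<close>

definition bq_vertex ::
  "('v, 'e) pre_digraph \<Rightarrow> (('v, 'e) qpath \<Rightarrow>\<^sub>0 'k::comm_ring_1) set \<Rightarrow> 'v \<Rightarrow> (('v, 'e) qpath \<Rightarrow>\<^sub>0 'k) set" where
  "bq_vertex Q I v = I +>\<^bsub>path_algebra Q\<^esub> path_vertex v"

definition bq_arrow ::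
  "('v, 'e) pre_digraph \<Rightarrow> (('v, 'e) qpath \<Rightarrow>\<^sub>0 'k::comm_ring_1) set \<Rightarrow> 'e \<Rightarrow> (('v, 'e) qpath \<Rightarrow>\<^sub>0 'k) set" where
  "bq_arrow Q I a = I +>\<^bsub>path_algebra Q\<^esub> path_arrow Q a"

definition bq_scalars ::
  "('v, 'e) pre_digraph \<Rightarrow> (('v, 'e) qpath \<Rightarrow>\<^sub>0 'k::comm_ring_1) set \<Rightarrow> (('v, 'e) qpath \<Rightarrow>\<^sub>0 'k) set set" where
  "bq_scalars Q I =
    {I +>\<^bsub>path_algebra Q\<^esub> (\<Sum>v\<in>verts Q. Poly_Mapping.single (v, [], v) c) | c. True}"


section \<open>Subalgebras\<close>

text \<open>
  \<open>K\<close> is the image of the base field in \<open>A\<close>. The library locale \<^locale>\<open>subalgebra\<close> only says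
  that \<open>B\<close> is a \<open>K\<close>-subspace of \<open>A\<close>.
\<close>

definition unital_subalgebra :: "'a set \<Rightarrow> 'a set \<Rightarrow> 'a ring \<Rightarrow> bool" where
  "unital_subalgebra K B A \<longleftrightarrow> subring B A \<and> subalgebra K B A"

definition generated_subalgebra :: "'a set \<Rightarrow> 'a ring \<Rightarrow> 'a set \<Rightarrow> 'a set" where
  "generated_subalgebra K A X = \<Inter>{B. unital_subalgebra K B A \<and> X \<subseteq> B}"

definition conjugate_in :: "'a ring \<Rightarrow> 'a set \<Rightarrow> 'a set \<Rightarrow> bool" where
  "conjugate_in A B C \<longleftrightarrow>
    (\<exists>z\<in>Units A. C = {z \<otimes>\<^bsub>A\<^esub> b \<otimes>\<^bsub>A\<^esub> inv\<^bsub>A\<^esub> z | b. b \<in> B})"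


section \<open>Left modules\<close>

text \<open>
  The library locale \<^locale>\<open>module\<close> requires a commutative ring. As there, the fields
  \<open>mult\<close> and \<open>one\<close> of the module record play no role.
\<close>

locale left_module = R?: ring R + M?: abelian_group M
  for R :: "('a, 'r) ring_scheme" and M :: "('a, 'b, 'm) module_scheme" (structure) +
  assumes smult_closed:
      "\<lbrakk>a \<in> carrier R; x \<in> carrier M\<rbrakk> \<Longrightarrow> a \<odot>\<^bsub>M\<^esub> x \<in> carrier M"
    and smult_l_distr:
      "\<lbrakk>a \<in> carrier R; b \<in> carrier R; x \<in> carrier M\<rbrakk> \<Longrightarrow>
        (a \<oplus>\<^bsub>R\<^esub> b) \<odot>\<^bsub>M\<^esub> x = a \<odot>\<^bsub>M\<^esub> x \<oplus>\<^bsub>M\<^esub> b \<odot>\<^bsub>M\<^esub> x"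
    and smult_r_distr:
      "\<lbrakk>a \<in> carrier R; x \<in> carrier M; y \<in> carrier M\<rbrakk> \<Longrightarrow>
        a \<odot>\<^bsub>M\<^esub> (x \<oplus>\<^bsub>M\<^esub> y) = a \<odot>\<^bsub>M\<^esub> x \<oplus>\<^bsub>M\<^esub> a \<odot>\<^bsub>M\<^esub> y"
    and smult_assoc:
      "\<lbrakk>a \<in> carrier R; b \<in> carrier R; x \<in> carrier M\<rbrakk> \<Longrightarrow>
        (a \<otimes>\<^bsub>R\<^esub> b) \<odot>\<^bsub>M\<^esub> x = a \<odot>\<^bsub>M\<^esub> (b \<odot>\<^bsub>M\<^esub> x)"
    and smult_one:
      "x \<in> carrier M \<Longrightarrow> \<one>\<^bsub>R\<^esub> \<odot>\<^bsub>M\<^esub> x = x"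

definition module_hom ::
  "('a, 'r) ring_scheme \<Rightarrow> ('a, 'b, 'm) module_scheme \<Rightarrow> ('a, 'c, 'n) module_scheme \<Rightarrow> ('b \<Rightarrow> 'c) set" where
  "module_hom R M N =
    {h \<in> carrier M \<rightarrow> carrier N.
      (\<forall>x\<in>carrier M. \<forall>y\<in>carrier M. h (x \<oplus>\<^bsub>M\<^esub> y) = h x \<oplus>\<^bsub>N\<^esub> h y) \<and>
      (\<forall>a\<in>carrier R. \<forall>x\<in>carrier M. h (a \<odot>\<^bsub>M\<^esub> x) = a \<odot>\<^bsub>N\<^esub> h x)}"

definition module_iso ::
  "('a, 'r) ring_scheme \<Rightarrow> ('a, 'b, 'm) module_scheme \<Rightarrow> ('a, 'c, 'n) module_scheme \<Rightarrow> ('b \<Rightarrow> 'c) set" where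
  "module_iso R M N = {h \<in> module_hom R M N. bij_betw h (carrier M) (carrier N)}"

definition direct_summand ::
  "('a, 'r) ring_scheme \<Rightarrow> ('a, 'b, 'm) module_scheme \<Rightarrow> 'b set \<Rightarrow> bool" where
  "direct_summand R M N \<longleftrightarrow>
    submodule N R M \<and>
    (\<exists>N'. submodule N' R M \<and> N \<inter> N' = {\<zero>\<^bsub>M\<^esub>} \<and> N <+>\<^bsub>M\<^esub> N' = carrier M)"


section \<open>The tensor product over a subring\<close>

text \<open>
  \<open>A \<otimes>\<^sub>B V\<close>, for a subset \<open>B\<close> of \<open>carrier A\<close> that is a subring, is the free abelian group on
  \<open>A \<times> V\<close> modulo biadditivity and \<open>B\<close>-balancedness; \<open>A\<close> acts by \<open>a (c \<otimes> v) = (a c) \<otimes> v\<close>.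
  Balancedness over the scalars makes this the usual tensor product of \<open>k\<close>-spaces.
\<close>

definition tensor_relators ::
  "'a ring \<Rightarrow> 'a set \<Rightarrow> ('a, 'm) module \<Rightarrow> ('a \<times> 'm \<Rightarrow>\<^sub>0 int) set" where
  "tensor_relators A B V =
     {frag_of (a \<oplus>\<^bsub>A\<^esub> a', v) - frag_of (a, v) - frag_of (a', v) | a a' v.
        a \<in> carrier A \<and> a' \<in> carrier A \<and> v \<in> carrier V} \<union>
     {frag_of (a, v \<oplus>\<^bsub>V\<^esub> v') - frag_of (a, v) - frag_of (a, v') | a v v'.
        a \<in> carrier A \<and> v \<in> carrier V \<and> v' \<in> carrier V} \<union>
     {frag_of (a \<otimes>\<^bsub>A\<^esub> b, v) - frag_of (a, b \<odot>\<^bsub>V\<^esub> v) | a b v.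
        a \<in> carrier A \<and> b \<in> B \<and> v \<in> carrier V}"

definition tensor_module ::
  "'a ring \<Rightarrow> 'a set \<Rightarrow> ('a, 'm) module \<Rightarrow> ('a, ('a \<times> 'm \<Rightarrow>\<^sub>0 int) set) module" where
  "tensor_module A B V =
    (let F = free_Abelian_group (carrier A \<times> carrier V);
         N = generate F (tensor_relators A B V)
     in \<lparr> carrier = carrier (F Mod N),
          mult = undefined,
          one = undefined,
          zero = \<one>\<^bsub>F Mod N\<^esub>,
          add = (\<otimes>\<^bsub>F Mod N\<^esub>),
          smult = (\<lambda>a X. \<Union>x\<in>X. N #>\<^bsub>F\<^esub> frag_extend (\<lambda>(c, v). frag_of (a \<otimes>\<^bsub>A\<^esub> c, v)) x) \<rparr>)"


section \<open>Relative homological algebra\<close>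

text \<open>
  All \<open>A\<close>-modules in resolutions, and the \<open>B\<close>-modules \<open>V\<close> in \<open>A \<otimes>\<^sub>B V\<close>, have their elements in one
  type \<open>'u\<close>. If \<open>'u\<close> is infinite and has at least as many elements as \<open>A\<close>, this is no restriction:
  for \<open>M\<close> with elements in \<open>'u\<close>, the module \<open>A \<otimes>\<^sub>B M\<close> has an isomorphic copy in \<open>'u\<close>, hence so
  have the terms of a standard relative resolution of \<open>M\<close>, and \<open>P\<close> is \<open>(A,B)\<close>-projective
  iff it is a direct summand of \<open>A \<otimes>\<^sub>B P\<close>.
\<close>

definition rel_projective :: "'a ring \<Rightarrow> 'a set \<Rightarrow> ('a, 'u) module \<Rightarrow> bool" where
  "rel_projective A B P \<longleftrightarrow>
    left_module A P \<and>
    (\<exists>(V :: ('a, 'u) module) N.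
       left_module (A\<lparr>carrier := B\<rparr>) V \<and>
       direct_summand A (tensor_module A B V) N \<and>
       module_iso A P ((tensor_module A B V)\<lparr>carrier := N\<rparr>) \<noteq> {})"

text \<open>The sequence \<open>\<dots> \<rightarrow> X 2 \<rightarrow> X 1 \<rightarrow> X 0 \<rightarrow> 0\<close> with maps \<open>d i : X (i + 1) \<rightarrow> X i\<close>.\<close>

definition rel_exact ::
  "'a ring \<Rightarrow> 'a set \<Rightarrow> (nat \<Rightarrow> ('a, 'u) module) \<Rightarrow> (nat \<Rightarrow> 'u \<Rightarrow> 'u) \<Rightarrow> bool" where
  "rel_exact A B X d \<longleftrightarrow>
    (\<forall>i. left_module A (X i)) \<and>
    (\<forall>i. d i \<in> module_hom A (X (Suc i)) (X i)) \<and>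
    d 0 ` carrier (X 1) = carrier (X 0) \<and>
    (\<forall>i. d (Suc i) ` carrier (X (Suc (Suc i))) = a_kernel (X (Suc i)) (X i) (d i)) \<and>
    (\<forall>i. direct_summand (A\<lparr>carrier := B\<rparr>) (X (Suc i)) (a_kernel (X (Suc i)) (X i) (d i)))"

text \<open>
  \<open>0 \<rightarrow> P\<^sub>n \<rightarrow> \<dots> \<rightarrow> P\<^sub>0 \<rightarrow> M \<rightarrow> 0\<close>, as the sequence with \<open>X 0 = M\<close> and \<open>X (i + 1) = P\<^sub>i\<close>,
  continued by zero modules.
\<close>

definition rel_resolution ::
  "'a ring \<Rightarrow> 'a set \<Rightarrow> ('a, 'u) module \<Rightarrow> nat \<Rightarrow>
     (nat \<Rightarrow> ('a, 'u) module) \<Rightarrow> (nat \<Rightarrow> 'u \<Rightarrow> 'u) \<Rightarrow> bool" where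
  "rel_resolution A B M n X d \<longleftrightarrow>
    rel_exact A B X d \<and> X 0 = M \<and>
    (\<forall>i\<le>n. rel_projective A B (X (Suc i))) \<and>
    (\<forall>i>n. carrier (X (Suc i)) = {\<zero>\<^bsub>X (Suc i)\<^esub>})"

definition rel_pd :: "'a ring \<Rightarrow> 'a set \<Rightarrow> ('a, 'u) module \<Rightarrow> enat" where
  "rel_pd A B M = (INF n\<in>{n. \<exists>X d. rel_resolution A B M n X d}. enat n)"

definition rel_gldim :: "'u itself \<Rightarrow> 'a ring \<Rightarrow> 'a set \<Rightarrow> enat" where
  "rel_gldim _ A B = (SUP M\<in>{M :: ('a, 'u) module. left_module A M}. rel_pd A B M)"

end

theory Submission
  imports Defs
begin

text \<open>
  Conjugation is an automorphism of \<open>A\<close>, so one may think of \<open>B = C\<close>. Since the loops lie in \<open>B\<close>,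
  each corner \<open>e\<^sub>i A e\<^sub>i\<close> is contained in \<open>k e\<^sub>i + B\<close>, and the other corners of \<open>B\<close> lie in \<open>B\<close>. Hence
  \<open>\<Sum> b e\<^sub>i \<otimes> e\<^sub>i = \<Sum> e\<^sub>i \<otimes> e\<^sub>i b\<close> in \<open>A \<otimes>\<^sub>B A\<close> for \<open>b \<in> B\<close>, so that \<open>a \<otimes> m \<mapsto> \<Sum> a e\<^sub>i \<otimes> e\<^sub>i m\<close> is an
  idempotent endomorphism of \<open>A \<otimes>\<^sub>B M\<close>. Its image \<open>P\<close> is relatively projective, and the action map
  \<open>P \<rightarrow> M\<close> is split over \<open>B\<close> by \<open>m \<mapsto> \<Sum> e\<^sub>i \<otimes> e\<^sub>i m\<close>. If \<open>i\<close> is maximal with \<open>e\<^sub>i M \<noteq> 0\<close>, then by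
  triangularity \<open>e\<^sub>i P\<close> maps bijectively onto \<open>e\<^sub>i M\<close>, and \<open>e\<^sub>j P = 0\<close> for \<open>j > i\<close>. The kernel therefore
  lives on the vertices below \<open>i\<close>, and after \<open>n\<close> such steps it vanishes.
\<close>

section \<open>Left modules\<close>

text \<open>The obstacle is that the \<open>e\<^sub>i\<close> need not lie in \<open>B\<close>: the
  vertices of \<open>R\<close> are only sums of vertices of \<open>Q\<close>. If \<open>D\<close>
  denotes the subring generated by \<open>B\<close> and all \<open>e\<^sub>i\<close>, then
  \<open>P\<close> is a copy of \<open>A \<otimes>\<^sub>D M\<close>. The idempotent says that
  passing from \<open>B\<close> to \<open>D\<close> merely cuts out a direct summand of
  \<open>A \<otimes>\<^sub>B M\<close>, so covers can be built as if the vertices belonged to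
  \<open>B\<close>.

  Paths never climb, so a closed path at \<open>i\<close> is a word in loops at \<open>i\<close>.
  This is why the loops alone control \<open>e\<^sub>i A e\<^sub>i\<close> up to multiples of the
  trivial path.

  The bijectivity at a top vertex \<open>i\<close> comes from a collapse:
  \<open>e\<^sub>i a e\<^sub>j = 0\<close> for \<open>j < i\<close> and
  \<open>e\<^sub>j M = 0\<close> for \<open>j > i\<close>, and what remains is \<open>e\<^sub>i a
  e\<^sub>i \<otimes> e\<^sub>i m = e\<^sub>i \<otimes> e\<^sub>i a m\<close>, which depends only on
  the image \<open>a m\<close>. A module living on the vertices \<open>1, \<dots>, k\<close> thus
  receives \<open>k\<close> projective terms, in degrees \<open>0\<close> to \<open>k - 1\<close>;
  hence the bound \<open>n - 1\<close>.

  A second concern is size: elements of a tensor product are cosets, of another type than the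
  elements of \<open>M\<close>, so each cover is copied back along an injection obtained by
  counting.\<close>

lemma (in left_module) smult_r_null:
  assumes "a \<in> carrier R" shows "a \<odot> \<zero> = \<zero>"
proof -
  have "a \<odot> \<zero> \<oplus> a \<odot> \<zero> = a \<odot> \<zero> \<oplus> \<zero>"
    using assms smult_r_distr[of a \<zero> \<zero>] by (simp add: smult_closed)
  then show ?thesis
    using assms by (simp add: smult_closed)
qed

lemma (in left_module) smult_l_null:
  assumes "x \<in> carrier M" shows "\<zero>\<^bsub>R\<^esub> \<odot> x = \<zero>"
proof -
  have "\<zero>\<^bsub>R\<^esub> \<odot> x \<oplus> \<zero>\<^bsub>R\<^esub> \<odot> x = \<zero>\<^bsub>R\<^esub> \<odot> x \<oplus> \<zero>"
    using assms smult_l_distr[of "\<zero>\<^bsub>R\<^esub>" "\<zero>\<^bsub>R\<^esub>" x] by (simp add: smult_closed)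
  then show ?thesis
    using assms by (simp add: smult_closed)
qed

lemma (in left_module) smult_finsum:
  assumes "a \<in> carrier R" "f \<in> S \<rightarrow> carrier M"
  shows "a \<odot> (\<Oplus>i\<in>S. f i) = (\<Oplus>i\<in>S. a \<odot> f i)"
  using assms(2)
  by (induction S rule: infinite_finite_induct)
    (auto simp: smult_r_null assms(1) smult_r_distr M.finsum_insert Pi_iff smult_closed)

lemma (in left_module) finsum_smult:
  assumes "x \<in> carrier M" "f \<in> S \<rightarrow> carrier R"
  shows "(\<Oplus>\<^bsub>R\<^esub>i\<in>S. f i) \<odot> x = (\<Oplus>i\<in>S. f i \<odot> x)"
  using assms(2)
  by (induction S rule: infinite_finite_induct)
    (auto simp: smult_l_null assms(1) smult_l_distr M.finsum_insert R.finsum_insert Pi_iff smult_closed)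

lemma (in abelian_monoid) finsum_exchange:
  assumes "finite I" "finite J" "\<And>i j. i \<in> I \<Longrightarrow> j \<in> J \<Longrightarrow> f i j \<in> carrier G"
  shows "(\<Oplus>i\<in>I. \<Oplus>j\<in>J. f i j) = (\<Oplus>j\<in>J. \<Oplus>i\<in>I. f i j)"
  using assms(1,3)
proof (induction I rule: finite_induct)
  case empty
  then show ?case by simp
next
  case (insert i I)
  have "(\<Oplus>j\<in>J. \<Oplus>i\<in>insert i I. f i j) = (\<Oplus>j\<in>J. f i j \<oplus> (\<Oplus>i\<in>I. f i j))"
    using insert by (intro finsum_cong') (auto intro!: finsum_closed simp: finsum_insert Pi_iff)
  also have "\<dots> = (\<Oplus>j\<in>J. f i j) \<oplus> (\<Oplus>j\<in>J. \<Oplus>i\<in>I. f i j)"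
    using insert by (intro finsum_addf) auto
  finally show ?case
    using insert by (simp add: finsum_insert Pi_iff)
qed

lemma (in abelian_monoid) finsum_delta:
  assumes "finite I" "k \<in> I" "\<And>i. i \<in> I \<Longrightarrow> i \<noteq> k \<Longrightarrow> f i = \<zero>" "f k \<in> carrier G"
  shows "(\<Oplus>i\<in>I. f i) = f k"
proof -
  have "(\<Oplus>i\<in>I. f i) = (\<Oplus>i\<in>insert k (I - {k}). f i)"
    using assms(2) by (simp add: insert_absorb)
  also have "\<dots> = f k \<oplus> (\<Oplus>i\<in>I - {k}. f i)"
    using assms by (intro finsum_insert) auto
  also have "(\<Oplus>i\<in>I - {k}. f i) = (\<Oplus>i\<in>I - {k}. \<zero>)"
    using assms by (intro finsum_cong') auto
  finally show ?thesis using assms by simp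
qed

section \<open>Homomorphisms, submodules, copies and splittings of modules\<close>

lemma module_hom_hom:
  "h \<in> module_hom R M N \<Longrightarrow> h \<in> hom (add_monoid M) (add_monoid N)"
  by (simp add: module_hom_def hom_def)

lemma module_homD:
  assumes "h \<in> module_hom R M N"
  shows "x \<in> carrier M \<Longrightarrow> h x \<in> carrier N"
    and "x \<in> carrier M \<Longrightarrow> y \<in> carrier M \<Longrightarrow> h (x \<oplus>\<^bsub>M\<^esub> y) = h x \<oplus>\<^bsub>N\<^esub> h y"
    and "a \<in> carrier R \<Longrightarrow> x \<in> carrier M \<Longrightarrow> h (a \<odot>\<^bsub>M\<^esub> x) = a \<odot>\<^bsub>N\<^esub> h x"
  using assms by (auto simp: module_hom_def)

lemma module_hom_group_hom:
  assumes "abelian_group M" "abelian_group N" "h \<in> module_hom R M N"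
  shows "group_hom (add_monoid M) (add_monoid N) h"
  using assms by (simp add: group_hom_def group_hom_axioms_def abelian_group.a_group module_hom_hom)

lemma module_hom_zero:
  assumes "abelian_group M" "abelian_group N" "h \<in> module_hom R M N"
  shows "h \<zero>\<^bsub>M\<^esub> = \<zero>\<^bsub>N\<^esub>"
  using group_hom.hom_one[OF module_hom_group_hom[OF assms]] by simp

lemma module_hom_minus:
  assumes "abelian_group M" "abelian_group N" "h \<in> module_hom R M N" "x \<in> carrier M"
  shows "h (\<ominus>\<^bsub>M\<^esub> x) = \<ominus>\<^bsub>N\<^esub> h x"
  using group_hom.hom_inv[OF module_hom_group_hom[OF assms(1-3)]] assms(4) by (simp add: a_inv_def)

lemma hom_finsum:
  assumes M: "abelian_group M" and N: "abelian_group N"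
    and h: "h \<in> hom (add_monoid M) (add_monoid N)" and f: "f \<in> S \<rightarrow> carrier M"
  shows "h (finsum M f S) = finsum N (\<lambda>i. h (f i)) S"
proof -
  interpret M: abelian_group M by (rule M)
  interpret N: abelian_group N by (rule N)
  interpret h: group_hom "add_monoid M" "add_monoid N" h
    using h by (simp add: group_hom_def group_hom_axioms_def M.a_group N.a_group)
  have z: "h \<zero>\<^bsub>M\<^esub> = \<zero>\<^bsub>N\<^esub>" using h.hom_one by simp
  have cl: "h x \<in> carrier N" if "x \<in> carrier M" for x using h.hom_closed that by simp
  have ad: "h (x \<oplus>\<^bsub>M\<^esub> y) = h x \<oplus>\<^bsub>N\<^esub> h y" if "x \<in> carrier M" "y \<in> carrier M" for x y
    using h.hom_mult that by simp
  show ?thesis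
    using f
    by (induction S rule: infinite_finite_induct) (simp_all add: z cl ad Pi_iff)
qed

lemma submoduleI':
  assumes "abelian_group M" "H \<subseteq> carrier M" "\<zero>\<^bsub>M\<^esub> \<in> H"
    and "\<And>x. x \<in> H \<Longrightarrow> \<ominus>\<^bsub>M\<^esub> x \<in> H"
    and "\<And>x y. x \<in> H \<Longrightarrow> y \<in> H \<Longrightarrow> x \<oplus>\<^bsub>M\<^esub> y \<in> H"
    and "\<And>a x. a \<in> carrier R \<Longrightarrow> x \<in> H \<Longrightarrow> a \<odot>\<^bsub>M\<^esub> x \<in> H"
  shows "submodule H R M"
  using assms by (intro submodule.intro subgroup.intro) (auto simp: submodule_axioms_def a_inv_def)

lemma submodule_kernel:
  assumes "left_module R M" "left_module R N" "h \<in> module_hom R M N"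
  shows "submodule (a_kernel M N h) R M"
proof -
  interpret M: left_module R M by fact
  interpret N: left_module R N by fact
  note ab = M.M.abelian_group_axioms N.M.abelian_group_axioms
  show ?thesis
    by (rule submoduleI')
      (auto simp: a_kernel_def' module_hom_zero[OF ab assms(3)] module_homD[OF assms(3)]
        module_hom_minus[OF ab assms(3)] M.smult_closed N.smult_r_null ab)
qed

lemma submodule_image:
  assumes "left_module R M" "left_module R N" "h \<in> module_hom R M N"
  shows "submodule (h ` carrier M) R N"
proof -
  interpret M: left_module R M by fact
  interpret N: left_module R N by fact
  note ab = M.M.abelian_group_axioms N.M.abelian_group_axioms
  show ?thesis
  proof (rule submoduleI'; (clarify)?)
    show "\<zero>\<^bsub>N\<^esub> \<in> h ` carrier M"
      using module_hom_zero[OF ab assms(3)] M.M.zero_closed by (metis imageI)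
  next
    fix x assume "x \<in> carrier M"
    then show "\<ominus>\<^bsub>N\<^esub> h x \<in> h ` carrier M"
      using module_hom_minus[OF ab assms(3)] M.M.a_inv_closed by (metis imageI)
  next
    fix x y assume "x \<in> carrier M" "y \<in> carrier M"
    then show "h x \<oplus>\<^bsub>N\<^esub> h y \<in> h ` carrier M"
      using module_homD[OF assms(3)] M.M.add.m_closed by (metis imageI)
  next
    fix a x assume "a \<in> carrier R" "x \<in> carrier M"
    then show "a \<odot>\<^bsub>N\<^esub> h x \<in> h ` carrier M"
      using module_homD[OF assms(3)] M.smult_closed by (metis imageI)
  qed (auto simp: ab module_homD[OF assms(3)])
qed

lemma left_module_submodule:
  assumes "left_module R M" "submodule H R M"
  shows "left_module R (M\<lparr>carrier := H\<rparr>)"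
proof -
  interpret M: left_module R M by fact
  interpret H: submodule H R M by fact
  have H: "x \<in> H \<Longrightarrow> x \<in> carrier M" for x using H.subset by auto
  have H_add: "x \<in> H \<Longrightarrow> y \<in> H \<Longrightarrow> x \<oplus>\<^bsub>M\<^esub> y \<in> H" for x y using H.m_closed by simp
  have H_zero: "\<zero>\<^bsub>M\<^esub> \<in> H" using H.one_closed by simp
  have ag: "abelian_group (M\<lparr>carrier := H\<rparr>)"
  proof (rule abelian_groupI)
    fix x assume "x \<in> carrier (M\<lparr>carrier := H\<rparr>)"
    then have x: "x \<in> H" by simp
    then have "\<ominus>\<^bsub>M\<^esub> x \<in> H" using H.m_inv_closed by (simp add: a_inv_def)
    then show "\<exists>y\<in>carrier (M\<lparr>carrier := H\<rparr>). y \<oplus>\<^bsub>M\<lparr>carrier := H\<rparr>\<^esub> x = \<zero>\<^bsub>M\<lparr>carrier := H\<rparr>\<^esub>"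
      using x H M.M.l_neg by auto
  qed (auto simp: H H_add H_zero M.M.a_assoc M.M.a_comm M.M.a_lcomm)
  then show ?thesis
    by (intro left_module.intro left_module_axioms.intro M.R.ring_axioms)
      (auto simp: H M.smult_l_distr M.smult_r_distr M.smult_assoc M.smult_one)
qed

lemma left_module_restrict_ring:
  assumes "left_module R M" "subring S R"
  shows "left_module (R\<lparr>carrier := S\<rparr>) M"
proof -
  interpret M: left_module R M by fact
  have S: "x \<in> S \<Longrightarrow> x \<in> carrier R" for x using subringE(1)[OF assms(2)] by auto
  show ?thesis
    using M.R.subring_is_ring[OF assms(2)]
    by (intro left_module.intro left_module_axioms.intro M.M.abelian_group_axioms)
      (auto simp: S M.smult_closed M.smult_l_distr M.smult_r_distr M.smult_assoc M.smult_one)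
qed

text \<open>Tensor products have cosets as elements, whereas all terms of a resolution must have
  their elements in one type; this is the copy of \<open>M\<close> along an injection
  \<open>\<phi>\<close>.\<close>

definition transport :: "('b \<Rightarrow> 'c) \<Rightarrow> ('a, 'b, 'm) module_scheme \<Rightarrow> ('a, 'c) module" where
  "transport \<phi> M =
    \<lparr> carrier = \<phi> ` carrier M, mult = undefined, one = undefined,
      zero = \<phi> \<zero>\<^bsub>M\<^esub>,
      add = (\<lambda>x y. \<phi> (the_inv_into (carrier M) \<phi> x \<oplus>\<^bsub>M\<^esub> the_inv_into (carrier M) \<phi> y)),
      smult = (\<lambda>a x. \<phi> (a \<odot>\<^bsub>M\<^esub> the_inv_into (carrier M) \<phi> x)) \<rparr>"

text \<open>The isomorphism is given from the copy back to \<open>M\<close>, the direction in which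
  \<open>rel_projective\<close> asks for it.\<close>

lemma transport_props:
  assumes M: "left_module R M" and inj: "inj_on \<phi> (carrier M)"
  shows "left_module R (transport \<phi> M)"
    and "the_inv_into (carrier M) \<phi> \<in> module_iso R (transport \<phi> M) M"
proof -
  interpret M: left_module R M by (rule M)
  have inv: "the_inv_into (carrier M) \<phi> (\<phi> x) = x" if "x \<in> carrier M" for x
    using that by (rule the_inv_into_f_f[OF inj])
  have ag: "abelian_group (transport \<phi> M)"
  proof (rule abelian_groupI)
    fix x assume "x \<in> carrier (transport \<phi> M)"
    then show "\<exists>y\<in>carrier (transport \<phi> M). y \<oplus>\<^bsub>transport \<phi> M\<^esub> x = \<zero>\<^bsub>transport \<phi> M\<^esub>"
      by (auto simp: transport_def inv M.M.l_neg intro!: bexI[of _ "\<ominus>\<^bsub>M\<^esub> _"])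
  qed (auto simp: transport_def inv M.M.a_assoc M.M.a_comm M.M.a_lcomm intro!: imageI)
  then show "left_module R (transport \<phi> M)"
    by (intro left_module.intro left_module_axioms.intro M.R.ring_axioms)
      (auto simp: transport_def inv M.smult_closed M.smult_l_distr M.smult_r_distr M.smult_assoc M.smult_one)
  have "bij_betw (the_inv_into (carrier M) \<phi>) (\<phi> ` carrier M) (carrier M)"
    using inj by (intro bij_betw_the_inv_into) (simp add: bij_betw_def)
  then show "the_inv_into (carrier M) \<phi> \<in> module_iso R (transport \<phi> M) M"
    by (auto simp: module_iso_def module_hom_def transport_def inv M.smult_closed)
qed

text \<open>Every \<open>x\<close> is the sum of \<open>x - s (d x)\<close>, in the kernel, and
  \<open>s (d x)\<close>, in the image. The first conclusion, over \<open>B\<close>, gives relative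
  exactness; the second, over \<open>A\<close>, makes the image of an idempotent a summand.\<close>

lemma direct_summand_section:
  assumes P: "left_module R P" and M: "left_module R M"
    and d: "d \<in> module_hom R P M" and s: "s \<in> module_hom R M P"
    and ds: "\<And>x. x \<in> carrier M \<Longrightarrow> d (s x) = x"
  shows "direct_summand R P (a_kernel P M d)" "direct_summand R P (s ` carrier M)"
proof -
  interpret P: left_module R P by (rule P)
  interpret M: left_module R M by (rule M)
  note ab = P.M.abelian_group_axioms M.M.abelian_group_axioms
  have K: "submodule (a_kernel P M d) R P" and S: "submodule (s ` carrier M) R P"
    using submodule_kernel[OF P M d] submodule_image[OF M P s] .
  have s0: "s \<zero>\<^bsub>M\<^esub> = \<zero>\<^bsub>P\<^esub>" and d0: "d \<zero>\<^bsub>P\<^esub> = \<zero>\<^bsub>M\<^esub>"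
    using module_hom_zero[OF _ _ s] module_hom_zero[OF _ _ d] ab by auto
  have int: "a_kernel P M d \<inter> s ` carrier M = {\<zero>\<^bsub>P\<^esub>}"
    using ds s0 d0 M.M.zero_closed by (auto simp: a_kernel_def' image_iff; metis)
  have sum: "a_kernel P M d <+>\<^bsub>P\<^esub> s ` carrier M = carrier P"
  proof (intro equalityI subsetI)
    fix x assume "x \<in> a_kernel P M d <+>\<^bsub>P\<^esub> s ` carrier M"
    then show "x \<in> carrier P"
      using module_homD(1)[OF s] by (auto simp: set_add_def' a_kernel_def')
  next
    fix x assume x: "x \<in> carrier P"
    define y where "y = s (d x)"
    have y: "y \<in> carrier P" "d y = d x" "y \<in> s ` carrier M"
      using x module_homD(1)[OF s] module_homD(1)[OF d] ds by (auto simp: y_def)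
    have "x \<oplus>\<^bsub>P\<^esub> \<ominus>\<^bsub>P\<^esub> y \<in> a_kernel P M d"
      using x y module_homD(1)[OF d] module_homD(2)[OF d, of x "\<ominus>\<^bsub>P\<^esub> y"] module_hom_minus[OF ab d]
      by (simp add: a_kernel_def' M.M.r_neg)
    moreover have "x = x \<oplus>\<^bsub>P\<^esub> \<ominus>\<^bsub>P\<^esub> y \<oplus>\<^bsub>P\<^esub> y"
      using x y by (simp add: P.M.a_assoc P.M.l_neg)
    ultimately show "x \<in> a_kernel P M d <+>\<^bsub>P\<^esub> s ` carrier M"
      using y(3) unfolding set_add_def' by blast
  qed
  show "direct_summand R P (a_kernel P M d)"
    unfolding direct_summand_def using K S int sum by blast
  have "s ` carrier M <+>\<^bsub>P\<^esub> a_kernel P M d = a_kernel P M d <+>\<^bsub>P\<^esub> s ` carrier M"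
  proof -
    have "h \<oplus>\<^bsub>P\<^esub> k = k \<oplus>\<^bsub>P\<^esub> h" if "h \<in> s ` carrier M" "k \<in> a_kernel P M d" for h k
      using that module_homD(1)[OF s] by (intro P.M.a_comm) (auto simp: a_kernel_def')
    then show ?thesis unfolding set_add_def' by (auto; metis imageI)
  qed
  then show "direct_summand R P (s ` carrier M)"
    unfolding direct_summand_def using K S int sum by (metis inf_commute)
qed

section \<open>The tensor product\<close>

locale tensor_product = A: ring A + V: abelian_group V
  for A :: "'a ring" and B :: "'a set" and V :: "('a, 'm) module" +
  assumes B_subset: "B \<subseteq> carrier A"
    and B_smult: "\<lbrakk>b \<in> B; v \<in> carrier V\<rbrakk> \<Longrightarrow> b \<odot>\<^bsub>V\<^esub> v \<in> carrier V"
begin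

abbreviation F :: "('a \<times> 'm \<Rightarrow>\<^sub>0 int) monoid" where
  "F \<equiv> free_Abelian_group (carrier A \<times> carrier V)"

abbreviation N :: "('a \<times> 'm \<Rightarrow>\<^sub>0 int) set" where
  "N \<equiv> generate F (tensor_relators A B V)"

abbreviation T :: "('a, ('a \<times> 'm \<Rightarrow>\<^sub>0 int) set) module" where
  "T \<equiv> tensor_module A B V"

definition coset :: "('a \<times> 'm \<Rightarrow>\<^sub>0 int) \<Rightarrow> ('a \<times> 'm \<Rightarrow>\<^sub>0 int) set" where
  "coset x = N #>\<^bsub>F\<^esub> x"

definition tens :: "'a \<Rightarrow> 'm \<Rightarrow> ('a \<times> 'm \<Rightarrow>\<^sub>0 int) set" where
  "tens a v = coset (frag_of (a, v))"

text \<open>The action of \<open>a\<close> on representatives, as it occurs in the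
  \<open>smult\<close> field of \<open>tensor_module\<close>.\<close>

definition lmul :: "'a \<Rightarrow> ('a \<times> 'm \<Rightarrow>\<^sub>0 int) \<Rightarrow> ('a \<times> 'm \<Rightarrow>\<^sub>0 int)" where
  "lmul a = frag_extend (\<lambda>(c, v). frag_of (a \<otimes>\<^bsub>A\<^esub> c, v))"

sublocale F: comm_group F by (rule abelian_free_Abelian_group)

lemma frag_of_closed: "a \<in> carrier A \<Longrightarrow> v \<in> carrier V \<Longrightarrow> frag_of (a, v) \<in> carrier F"
  by (simp add: keys_frag_of)

lemma diff_closed: "x \<in> carrier F \<Longrightarrow> y \<in> carrier F \<Longrightarrow> x - y \<in> carrier F"
  using keys_diff[of x y] by auto

lemma add_closed: "x \<in> carrier F \<Longrightarrow> y \<in> carrier F \<Longrightarrow> x + y \<in> carrier F"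
  using F.m_closed by simp

lemma zero_closed_F: "0 \<in> carrier F"
  by simp

lemma relators_l_add:
  "\<lbrakk>a \<in> carrier A; a' \<in> carrier A; v \<in> carrier V\<rbrakk> \<Longrightarrow>
    frag_of (a \<oplus>\<^bsub>A\<^esub> a', v) - frag_of (a, v) - frag_of (a', v) \<in> tensor_relators A B V"
  unfolding tensor_relators_def by blast

lemma relators_r_add:
  "\<lbrakk>a \<in> carrier A; v \<in> carrier V; v' \<in> carrier V\<rbrakk> \<Longrightarrow>
    frag_of (a, v \<oplus>\<^bsub>V\<^esub> v') - frag_of (a, v) - frag_of (a, v') \<in> tensor_relators A B V"
  unfolding tensor_relators_def by blast

lemma relators_balanced:
  "\<lbrakk>a \<in> carrier A; b \<in> B; v \<in> carrier V\<rbrakk> \<Longrightarrow>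
    frag_of (a \<otimes>\<^bsub>A\<^esub> b, v) - frag_of (a, b \<odot>\<^bsub>V\<^esub> v) \<in> tensor_relators A B V"
  unfolding tensor_relators_def by blast

lemma relators_cases:
  assumes "x \<in> tensor_relators A B V"
  obtains (l_add) a a' v where "a \<in> carrier A" "a' \<in> carrier A" "v \<in> carrier V"
      "x = frag_of (a \<oplus>\<^bsub>A\<^esub> a', v) - frag_of (a, v) - frag_of (a', v)"
    | (r_add) a v v' where "a \<in> carrier A" "v \<in> carrier V" "v' \<in> carrier V"
      "x = frag_of (a, v \<oplus>\<^bsub>V\<^esub> v') - frag_of (a, v) - frag_of (a, v')"
    | (balanced) a b v where "a \<in> carrier A" "b \<in> B" "v \<in> carrier V"
      "x = frag_of (a \<otimes>\<^bsub>A\<^esub> b, v) - frag_of (a, b \<odot>\<^bsub>V\<^esub> v)"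
  using assms unfolding tensor_relators_def
  by (elim UnE CollectE exE conjE) (rule that; assumption)+

lemma relators_closed: "tensor_relators A B V \<subseteq> carrier F"
  unfolding tensor_relators_def using B_subset
  by (auto simp del: carrier_free_Abelian_group_iff
      intro!: diff_closed frag_of_closed B_smult)

lemma N_subgroup: "subgroup N F"
  using relators_closed by (rule F.generate_is_subgroup)

lemma N_normal: "N \<lhd> F"
  using N_subgroup by (rule F.subgroup_imp_normal)

lemma diff_eq: "x \<in> carrier F \<Longrightarrow> y \<in> carrier F \<Longrightarrow> x \<otimes>\<^bsub>F\<^esub> inv\<^bsub>F\<^esub> y = x - y"
  by simp

lemma coset_eq_iff:
  assumes "x \<in> carrier F" "y \<in> carrier F"
  shows "coset x = coset y \<longleftrightarrow> x - y \<in> N"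
  unfolding coset_def
  using assms diff_eq[OF assms] N_subgroup
  by (metis F.group_axioms F.rcos_self F.repr_independence subgroup.rcos_module)

section \<open>The action of the ring on cosets\<close>

lemma lmul_of [simp]: "lmul a (frag_of (c, v)) = frag_of (a \<otimes>\<^bsub>A\<^esub> c, v)"
  by (simp add: lmul_def)

lemma lmul_diff: "lmul a (x - y) = lmul a x - lmul a y"
  by (simp add: lmul_def frag_extend_diff)

lemma lmul_add: "lmul a (x + y) = lmul a x + lmul a y"
  by (simp add: lmul_def frag_extend_add)

lemma lmul_closed:
  assumes "a \<in> carrier A" "x \<in> carrier F"
  shows "lmul a x \<in> carrier F"
proof -
  have "Poly_Mapping.keys x \<subseteq> carrier A \<times> carrier V" using assms by simp
  then show ?thesis
  proof (induction rule: frag_induction)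
    case zero
    then show ?case by (simp add: lmul_def)
  next
    case (one p)
    then show ?case using assms(1) by (cases p) (auto simp: keys_frag_of)
  next
    case (diff y z)
    then show ?case unfolding lmul_diff by (intro diff_closed)
  qed
qed

text \<open>Left multiplication does not meet the balancing, which takes place on the right of
  \<open>c\<close>: \<open>a (c b) = (a c) b\<close>. So the action descends to the
  quotient.\<close>

lemma lmul_relators:
  assumes a: "a \<in> carrier A" and "x \<in> tensor_relators A B V"
  shows "lmul a x \<in> tensor_relators A B V"
  using assms(2)
proof (cases rule: relators_cases)
  case (l_add c c' v)
  then show ?thesis
    using a relators_l_add[of "a \<otimes>\<^bsub>A\<^esub> c" "a \<otimes>\<^bsub>A\<^esub> c'" v] by (simp add: lmul_diff A.r_distr)
next
  case (r_add c v v')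
  then show ?thesis
    using a relators_r_add[of "a \<otimes>\<^bsub>A\<^esub> c" v v'] by (simp add: lmul_diff)
next
  case (balanced c b v)
  then have "b \<in> carrier A" using B_subset by blast
  then show ?thesis
    using a balanced relators_balanced[of "a \<otimes>\<^bsub>A\<^esub> c" b v] by (simp add: lmul_diff A.m_assoc)
qed

lemma lmul_N:
  assumes a: "a \<in> carrier A" and "x \<in> N"
  shows "lmul a x \<in> N"
  using assms(2)
proof (induction rule: generate.induct)
  case one
  then show ?case using generate.one[of F] by (simp add: lmul_def)
next
  case (incl h)
  then show ?case by (intro generate.incl lmul_relators a)
next
  case (inv h)
  then have h: "h \<in> carrier F" using relators_closed by blast
  have "inv\<^bsub>F\<^esub> (lmul a h) \<in> N" using inv by (intro generate.inv lmul_relators a)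
  moreover have "inv\<^bsub>F\<^esub> (lmul a h) = lmul a (inv\<^bsub>F\<^esub> h)"
    using h lmul_closed[OF a h] by (simp add: lmul_def frag_extend_minus)
  ultimately show ?case by simp
next
  case (eng h1 h2)
  then show ?case using generate.eng[of "lmul a h1" F _ "lmul a h2"] by (simp add: lmul_add)
qed

lemma carrier_T: "carrier T = coset ` carrier F"
  by (simp add: tensor_module_def Let_def carrier_FactGroup coset_def image_def)

lemma coset_closed [simp]: "x \<in> carrier F \<Longrightarrow> coset x \<in> carrier T"
  unfolding carrier_T by blast

lemma zero_T: "\<zero>\<^bsub>T\<^esub> = coset 0"
proof -
  have "\<zero>\<^bsub>T\<^esub> = N" by (simp add: tensor_module_def Let_def)
  also have "N = coset 0"
    unfolding coset_def using F.coset_mult_one[OF subgroup.subset[OF N_subgroup]] by simp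
  finally show ?thesis .
qed

lemma add_T: "x \<in> carrier F \<Longrightarrow> y \<in> carrier F \<Longrightarrow> coset x \<oplus>\<^bsub>T\<^esub> coset y = coset (x + y)"
  using normal.rcos_sum[OF N_normal]
  by (simp add: tensor_module_def Let_def coset_def)

text \<open>The record defines the product as a union of cosets over all representatives. The union
  is a single coset because \<open>lmul a\<close> maps \<open>N\<close> into itself.\<close>

lemma smult_T:
  assumes a: "a \<in> carrier A" and x: "x \<in> carrier F"
  shows "a \<odot>\<^bsub>T\<^esub> coset x = coset (lmul a x)"
proof -
  have eq: "coset (lmul a y) = coset (lmul a x)" if "y \<in> coset x" for y
  proof -
    have y: "y \<in> carrier F"
      using that x N_subgroup F.r_coset_subset_G subgroup.subset unfolding coset_def by blast
    have "coset y = coset x"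
      using that x N_subgroup unfolding coset_def by (metis F.repr_independence)
    then have "y - x \<in> N" using x y coset_eq_iff by blast
    then have "lmul a y - lmul a x \<in> N" using lmul_N[OF a] by (metis lmul_diff)
    then show ?thesis using coset_eq_iff a x y lmul_closed by blast
  qed
  have "x \<in> coset x"
    using x N_subgroup unfolding coset_def by (intro F.rcos_self)
  then have "(\<Union>y\<in>coset x. coset (lmul a y)) = coset (lmul a x)"
    using eq by (intro UN_constant_eq ballI)
  moreover have "a \<odot>\<^bsub>T\<^esub> coset x = (\<Union>y\<in>coset x. coset (lmul a y))"
    by (simp add: tensor_module_def Let_def coset_def lmul_def)
  ultimately show ?thesis by simp
qed

lemma T_abelian_group: "abelian_group T"
proof (rule abelian_groupI)
  fix x assume "x \<in> carrier T"
  then obtain a where a: "x = coset a" "a \<in> carrier F" unfolding carrier_T by blast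
  have "- a \<in> carrier F" using a by simp
  then show "\<exists>y\<in>carrier T. y \<oplus>\<^bsub>T\<^esub> x = \<zero>\<^bsub>T\<^esub>"
    using a by (intro bexI[of _ "coset (- a)"]) (simp_all add: zero_closed_F add_T zero_T del: carrier_free_Abelian_group_iff)
qed (auto simp: carrier_T add_T zero_T add_closed zero_closed_F
    ac_simps simp del: carrier_free_Abelian_group_iff intro!: imageI)

text \<open>Unlike associativity and the unit law, which hold for representatives, additivity in the
  ring element holds only modulo the first family of relators: \<open>frag_of\<close> is not
  additive in \<open>c\<close>.\<close>

lemma lmul_l_distr:
  assumes "a \<in> carrier A" "b \<in> carrier A" "x \<in> carrier F"
  shows "lmul (a \<oplus>\<^bsub>A\<^esub> b) x - lmul a x - lmul b x \<in> N"
proof -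
  have sub: "u - v \<in> N" if "u \<in> N" "v \<in> N" for u v
    using F.m_closed that N_subgroup subgroup.subset[OF N_subgroup]
      subgroup.m_closed[OF N_subgroup that(1) subgroup.m_inv_closed[OF N_subgroup that(2)]]
    by auto
  have "Poly_Mapping.keys x \<subseteq> carrier A \<times> carrier V" using assms by simp
  then show ?thesis
  proof (induction rule: frag_induction)
    case zero
    then show ?case using generate.one[of F] by (simp add: lmul_def)
  next
    case (one x)
    then obtain c v where x: "x = (c, v)" "c \<in> carrier A" "v \<in> carrier V" by blast
    show ?case
      using assms x relators_l_add[of "a \<otimes>\<^bsub>A\<^esub> c" "b \<otimes>\<^bsub>A\<^esub> c" v]
      by (intro generate.incl) (simp add: A.l_distr)
  next
    case (diff y z)
    from sub[OF this] show ?case by (simp add: lmul_diff algebra_simps)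
  qed
qed

lemma lmul_assoc:
  assumes "a \<in> carrier A" "b \<in> carrier A" "x \<in> carrier F"
  shows "lmul (a \<otimes>\<^bsub>A\<^esub> b) x = lmul a (lmul b x)"
proof -
  have "Poly_Mapping.keys x \<subseteq> carrier A \<times> carrier V" using assms by simp
  then show ?thesis
    by (induction rule: frag_induction)
      (auto simp: lmul_diff A.m_assoc assms, simp_all add: lmul_def)
qed

lemma lmul_one:
  assumes "x \<in> carrier F"
  shows "lmul \<one>\<^bsub>A\<^esub> x = x"
proof -
  have "Poly_Mapping.keys x \<subseteq> carrier A \<times> carrier V" using assms by simp
  then show ?thesis
    by (induction rule: frag_induction) (auto simp: lmul_diff, simp_all add: lmul_def)
qed

lemma T_left_module: "left_module A T"
proof -
  interpret T: abelian_group T by (rule T_abelian_group)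
  show ?thesis
  proof (unfold_locales, goal_cases)
    case (1 a x)
    then show ?case by (auto simp: carrier_T smult_T lmul_closed simp del: carrier_free_Abelian_group_iff)
  next
    case (2 a b x)
    then obtain y where y: "x = coset y" "y \<in> carrier F" unfolding carrier_T by blast
    have "lmul (a \<oplus>\<^bsub>A\<^esub> b) y - (lmul a y + lmul b y) \<in> N"
      using lmul_l_distr[OF 2(1,2) y(2)] by (simp add: algebra_simps)
    then show ?case
      using 2 y by (simp add: smult_T lmul_closed add_T coset_eq_iff add_closed del: carrier_free_Abelian_group_iff)
  next
    case (3 a x y)
    then show ?case
      by (auto simp: carrier_T smult_T add_T lmul_closed lmul_add add_closed simp del: carrier_free_Abelian_group_iff)
  next
    case (4 a b x)
    then show ?case
      by (auto simp: carrier_T smult_T lmul_closed lmul_assoc simp del: carrier_free_Abelian_group_iff)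
  next
    case (5 x)
    then show ?case
      by (auto simp: carrier_T smult_T lmul_one simp del: carrier_free_Abelian_group_iff)
  qed
qed

sublocale T: left_module A T by (rule T_left_module)

section \<open>Pure tensors, the universal property and the size of the tensor product\<close>

lemma tens_closed [simp]: "a \<in> carrier A \<Longrightarrow> v \<in> carrier V \<Longrightarrow> tens a v \<in> carrier T"
  unfolding tens_def by (intro coset_closed frag_of_closed)

lemma relator_tens:
  assumes "x \<in> carrier F" "y \<in> carrier F" "z \<in> carrier F" "x - y - z \<in> N"
  shows "coset x = coset y \<oplus>\<^bsub>T\<^esub> coset z"
  using assms coset_eq_iff[of x "y + z"]
  by (simp add: add_T add_closed algebra_simps del: carrier_free_Abelian_group_iff)

lemma tens_l_add:
  assumes "a \<in> carrier A" "a' \<in> carrier A" "v \<in> carrier V"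
  shows "tens (a \<oplus>\<^bsub>A\<^esub> a') v = tens a v \<oplus>\<^bsub>T\<^esub> tens a' v"
  unfolding tens_def using assms
  by (intro relator_tens frag_of_closed generate.incl relators_l_add) simp_all

lemma tens_r_add:
  assumes "a \<in> carrier A" "v \<in> carrier V" "v' \<in> carrier V"
  shows "tens a (v \<oplus>\<^bsub>V\<^esub> v') = tens a v \<oplus>\<^bsub>T\<^esub> tens a v'"
  unfolding tens_def using assms
  by (intro relator_tens frag_of_closed generate.incl relators_r_add) simp_all

lemma tens_balanced:
  assumes "a \<in> carrier A" "b \<in> B" "v \<in> carrier V"
  shows "tens (a \<otimes>\<^bsub>A\<^esub> b) v = tens a (b \<odot>\<^bsub>V\<^esub> v)"
proof -
  have "frag_of (a \<otimes>\<^bsub>A\<^esub> b, v) - frag_of (a, b \<odot>\<^bsub>V\<^esub> v) \<in> N"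
    using assms by (intro generate.incl relators_balanced)
  then show ?thesis
    unfolding tens_def using assms B_subset
    by (subst coset_eq_iff) (auto intro!: frag_of_closed B_smult simp del: carrier_free_Abelian_group_iff)
qed

lemma smult_tens:
  "a \<in> carrier A \<Longrightarrow> c \<in> carrier A \<Longrightarrow> v \<in> carrier V \<Longrightarrow> a \<odot>\<^bsub>T\<^esub> tens c v = tens (a \<otimes>\<^bsub>A\<^esub> c) v"
  unfolding tens_def by (simp add: smult_T frag_of_closed del: carrier_free_Abelian_group_iff)

lemma T_induct [consumes 1, case_names zero tens add minus]:
  assumes "t \<in> carrier T"
    and "P \<zero>\<^bsub>T\<^esub>"
    and "\<And>a v. a \<in> carrier A \<Longrightarrow> v \<in> carrier V \<Longrightarrow> P (tens a v)"
    and add: "\<And>s t. s \<in> carrier T \<Longrightarrow> t \<in> carrier T \<Longrightarrow> P s \<Longrightarrow> P t \<Longrightarrow> P (s \<oplus>\<^bsub>T\<^esub> t)"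
    and minus: "\<And>t. t \<in> carrier T \<Longrightarrow> P t \<Longrightarrow> P (\<ominus>\<^bsub>T\<^esub> t)"
  shows "P t"
proof -
  obtain x where x: "t = coset x" "x \<in> carrier F" using assms(1) unfolding carrier_T by blast
  have "Poly_Mapping.keys x \<subseteq> carrier A \<times> carrier V" using x by simp
  then have "x \<in> carrier F \<and> P (coset x)"
  proof (induction rule: frag_induction)
    case zero
    then show ?case using assms(2) zero_T by simp
  next
    case (one x)
    then show ?case using assms(3) frag_of_closed by (auto simp: tens_def)
  next
    case (diff y z)
    then have *: "- z \<in> carrier F" "y \<in> carrier F" "z \<in> carrier F" by auto
    have "coset (- z) = \<ominus>\<^bsub>T\<^esub> coset z"
      using * by (intro T.M.minus_equality[symmetric])
        (auto simp: add_T zero_T simp del: carrier_free_Abelian_group_iff)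
    then have "P (coset (- z))" using minus diff by simp
    then have "P (coset y \<oplus>\<^bsub>T\<^esub> coset (- z))" using add * diff coset_closed by blast
    then show ?case using * diff_closed add_T[of y "- z"] by simp
  qed
  then show ?thesis using x by simp
qed

text \<open>Pure tensors generate the tensor product as an abelian group. Only additivity is asked
  for, so that maps such as \<open>t \<mapsto> e\<^sub>i \<pi>(t)\<close>, which need not be linear
  over \<open>A\<close>, can be compared as well.\<close>

lemma T_hom_eqI:
  assumes G: "abelian_group G"
    and h: "h \<in> hom (add_monoid T) (add_monoid G)" and g: "g \<in> hom (add_monoid T) (add_monoid G)"
    and eq: "\<And>a v. a \<in> carrier A \<Longrightarrow> v \<in> carrier V \<Longrightarrow> h (tens a v) = g (tens a v)"
    and t: "t \<in> carrier T"
  shows "h t = g t"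
proof -
  interpret G: abelian_group G by (rule G)
  interpret h: group_hom "add_monoid T" "add_monoid G" h
    using h by (simp add: group_hom_def group_hom_axioms_def G.a_group T.M.a_group)
  interpret g: group_hom "add_monoid T" "add_monoid G" g
    using g by (simp add: group_hom_def group_hom_axioms_def G.a_group T.M.a_group)
  show ?thesis
    using t
  proof (induction rule: T_induct)
    case zero
    then show ?case using h.hom_one g.hom_one by simp
  next
    case (tens a v)
    then show ?case by (rule eq)
  next
    case (add s t)
    then show ?case using h.hom_mult[of s t] g.hom_mult[of s t] by simp
  next
    case (minus t)
    then show ?case
      using h.hom_inv[of t] g.hom_inv[of t] by (simp add: a_inv_def[symmetric])
  qed
qed

lemma T_universal:
  assumes G: "abelian_group G"
    and closed: "\<And>a v. a \<in> carrier A \<Longrightarrow> v \<in> carrier V \<Longrightarrow> f a v \<in> carrier G"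
    and l_add: "\<And>a a' v. a \<in> carrier A \<Longrightarrow> a' \<in> carrier A \<Longrightarrow> v \<in> carrier V \<Longrightarrow>
        f (a \<oplus>\<^bsub>A\<^esub> a') v = f a v \<oplus>\<^bsub>G\<^esub> f a' v"
    and r_add: "\<And>a v v'. a \<in> carrier A \<Longrightarrow> v \<in> carrier V \<Longrightarrow> v' \<in> carrier V \<Longrightarrow>
        f a (v \<oplus>\<^bsub>V\<^esub> v') = f a v \<oplus>\<^bsub>G\<^esub> f a v'"
    and bal: "\<And>a b v. a \<in> carrier A \<Longrightarrow> b \<in> B \<Longrightarrow> v \<in> carrier V \<Longrightarrow>
        f (a \<otimes>\<^bsub>A\<^esub> b) v = f a (b \<odot>\<^bsub>V\<^esub> v)"
  obtains h where "h \<in> hom (add_monoid T) (add_monoid G)"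
    "\<And>a v. a \<in> carrier A \<Longrightarrow> v \<in> carrier V \<Longrightarrow> h (tens a v) = f a v"
proof -
  interpret G: abelian_group G by (rule G)
  have "case_prod f ` (carrier A \<times> carrier V) \<subseteq> carrier (add_monoid G)" using closed by auto
  then obtain h where h: "h \<in> hom F (add_monoid G)"
    "\<And>p. p \<in> carrier A \<times> carrier V \<Longrightarrow> h (frag_of p) = case_prod f p"
    by (rule comm_group.free_Abelian_group_universal[OF G.a_comm_group]) blast
  interpret h: group_hom F "add_monoid G" h
    using h(1) by (simp add: group_hom_def group_hom_axioms_def G.a_group F.group_axioms)
  have h_diff: "h (x - y) = h x \<ominus>\<^bsub>G\<^esub> h y" if "x \<in> carrier F" "y \<in> carrier F" for x y
    using h.hom_mult[of x "inv\<^bsub>F\<^esub> y"] h.hom_inv[of y] that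
    by (simp add: a_minus_def a_inv_def[symmetric])
  \<comment> \<open>The shape that the images of both kinds of additivity relators take;
    \<open>cancel'\<close> serves the balancing relators.\<close>
  have cancel: "u \<oplus>\<^bsub>G\<^esub> w \<ominus>\<^bsub>G\<^esub> u \<ominus>\<^bsub>G\<^esub> w = \<zero>\<^bsub>G\<^esub>"
    if "u \<in> carrier G" "w \<in> carrier G" for u w
    using that G.r_neg1[of u "w \<oplus>\<^bsub>G\<^esub> \<ominus>\<^bsub>G\<^esub> w"] G.r_neg2[of u "w \<oplus>\<^bsub>G\<^esub> \<ominus>\<^bsub>G\<^esub> w"]
      G.a_lcomm[of w "\<ominus>\<^bsub>G\<^esub> u" "\<ominus>\<^bsub>G\<^esub> w"]
    by (simp_all add: a_minus_def G.r_neg G.a_assoc)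
  have cancel': "u \<ominus>\<^bsub>G\<^esub> u = \<zero>\<^bsub>G\<^esub>" if "u \<in> carrier G" for u
    using that by (simp add: a_minus_def G.r_neg)
  have bA: "b \<in> carrier A" if "b \<in> B" for b using that B_subset by blast
  have "h x = \<zero>\<^bsub>G\<^esub>" if "x \<in> tensor_relators A B V" for x
    using that
    by (cases rule: relators_cases)
      (simp_all add: h_diff frag_of_closed diff_closed h(2) l_add r_add bal cancel cancel' closed B_smult bA
        del: carrier_free_Abelian_group_iff)
  then have "tensor_relators A B V \<subseteq> kernel F (add_monoid G) h"
    using relators_closed by (auto simp: kernel_def simp del: carrier_free_Abelian_group_iff)
  then have "N \<subseteq> kernel F (add_monoid G) h"
    using h.subgroup_kernel F.generate_subgroup_incl by blast
  then obtain g where g: "g \<in> hom (F Mod N) (add_monoid G)" "\<And>x. x \<in> carrier F \<Longrightarrow> g (N #>\<^bsub>F\<^esub> x) = h x"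
    using h.FactGroup_universal_kernel[OF N_normal] by metis
  show ?thesis
  proof
    show "g \<in> hom (add_monoid T) (add_monoid G)"
      using g(1) by (simp add: tensor_module_def Let_def hom_def)
    show "g (tens a v) = f a v" if "a \<in> carrier A" "v \<in> carrier V" for a v
      using that g(2)[of "frag_of (a, v)"] frag_of_closed[OF that] h(2)[of "(a, v)"]
      by (simp add: tens_def coset_def del: carrier_free_Abelian_group_iff)
  qed
qed

text \<open>A chain of cardinal estimates: cosets, then the free abelian group on pairs, then the
  pairs themselves, then the infinite type.\<close>

lemma T_lepoll:
  fixes \<iota> :: "'a \<Rightarrow> 'm"
  assumes "infinite (UNIV :: 'm set)" "inj_on \<iota> (carrier A)"
  obtains \<phi> :: "('a \<times> 'm \<Rightarrow>\<^sub>0 int) set \<Rightarrow> 'm" where "inj_on \<phi> (carrier T)"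
proof -
  \<comment> \<open>\<open>A\<close> contains its zero, so the product has at least one infinite
    row.\<close>
  have inf: "infinite (carrier A \<times> (UNIV :: 'm set))"
    using assms(1) A.zero_closed finite_cartesian_productD2 by blast
  have "carrier T \<lesssim> carrier F"
    unfolding carrier_T by (rule image_lepoll)
  \<comment> \<open>The module may be finite, and then the pairs need not form an infinite set;
    enlarging it to the whole type makes the set of generators infinite, as the count of a free
    abelian group requires.\<close>
  also have "carrier F \<lesssim> carrier (free_Abelian_group (carrier A \<times> (UNIV :: 'm set)))"
    by (rule subset_imp_lepoll) auto
  also have "\<dots> \<lesssim> carrier A \<times> (UNIV :: 'm set)"
    using eqpoll_free_Abelian_group_infinite[OF inf] by (rule eqpoll_imp_lepoll)
  also have "\<dots> \<lesssim> (UNIV :: 'm set) \<times> (UNIV :: 'm set)"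
    using assms(2) by (intro times_lepoll_mono) (auto simp: lepoll_def)
  also have "\<dots> \<lesssim> (UNIV :: 'm set)"
    using card_of_Times_same_infinite[OF assms(1)] eqpoll_iff_card_of_ordIso eqpoll_imp_lepoll by blast
  finally show ?thesis using that unfolding lepoll_def by blast
qed

end

text \<open>The additive map is linear over \<open>A\<close>, since \<open>h (a t)\<close> and
  \<open>a h(t)\<close> are both additive in \<open>t\<close> and agree on pure tensors by
  \<open>smult\<close>.\<close>

lemma (in tensor_product) T_universal_module:
  assumes G: "left_module A G"
    and closed: "\<And>a v. a \<in> carrier A \<Longrightarrow> v \<in> carrier V \<Longrightarrow> f a v \<in> carrier G"
    and l_add: "\<And>a a' v. a \<in> carrier A \<Longrightarrow> a' \<in> carrier A \<Longrightarrow> v \<in> carrier V \<Longrightarrow>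
        f (a \<oplus>\<^bsub>A\<^esub> a') v = f a v \<oplus>\<^bsub>G\<^esub> f a' v"
    and r_add: "\<And>a v v'. a \<in> carrier A \<Longrightarrow> v \<in> carrier V \<Longrightarrow> v' \<in> carrier V \<Longrightarrow>
        f a (v \<oplus>\<^bsub>V\<^esub> v') = f a v \<oplus>\<^bsub>G\<^esub> f a v'"
    and bal: "\<And>a b v. a \<in> carrier A \<Longrightarrow> b \<in> B \<Longrightarrow> v \<in> carrier V \<Longrightarrow>
        f (a \<otimes>\<^bsub>A\<^esub> b) v = f a (b \<odot>\<^bsub>V\<^esub> v)"
    and smult: "\<And>a c v. a \<in> carrier A \<Longrightarrow> c \<in> carrier A \<Longrightarrow> v \<in> carrier V \<Longrightarrow>
        f (a \<otimes>\<^bsub>A\<^esub> c) v = a \<odot>\<^bsub>G\<^esub> f c v"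
  obtains h where "h \<in> module_hom A T G"
    "\<And>a v. a \<in> carrier A \<Longrightarrow> v \<in> carrier V \<Longrightarrow> h (tens a v) = f a v"
proof -
  interpret G: left_module A G by (rule G)
  obtain h where h: "h \<in> hom (add_monoid T) (add_monoid G)"
    "\<And>a v. a \<in> carrier A \<Longrightarrow> v \<in> carrier V \<Longrightarrow> h (tens a v) = f a v"
    using T_universal[OF G.M.abelian_group_axioms closed l_add r_add bal] by blast
  have "h (a \<odot>\<^bsub>T\<^esub> t) = a \<odot>\<^bsub>G\<^esub> h t" if a: "a \<in> carrier A" and t: "t \<in> carrier T" for a t
  proof (rule T_hom_eqI[OF G.M.abelian_group_axioms _ _ _ t, of "\<lambda>t. h (a \<odot>\<^bsub>T\<^esub> t)" "\<lambda>t. a \<odot>\<^bsub>G\<^esub> h t"])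
    show "(\<lambda>t. h (a \<odot>\<^bsub>T\<^esub> t)) \<in> hom (add_monoid T) (add_monoid G)"
      "(\<lambda>t. a \<odot>\<^bsub>G\<^esub> h t) \<in> hom (add_monoid T) (add_monoid G)"
      using h(1) a by (auto simp: hom_def T.smult_r_distr T.smult_closed G.smult_r_distr G.smult_closed Pi_iff)
    show "h (a \<odot>\<^bsub>T\<^esub> tens c v) = a \<odot>\<^bsub>G\<^esub> h (tens c v)"
      if "c \<in> carrier A" "v \<in> carrier V" for c v
      using that a by (simp add: smult_tens h(2) smult)
  qed
  then have "h \<in> module_hom A T G" using h(1) by (auto simp: module_hom_def hom_def)
  then show ?thesis using that h(2) by blast
qed

section \<open>Triangular extensions\<close>

text \<open>What the homological argument uses about the bound quiver algebra, in a form that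
  involves only the ring \<open>A\<close> and is therefore stable under automorphisms. The
  \<open>e i\<close> are not assumed to lie in \<open>B\<close>. The assumption
  \<open>diagonal\<close> expresses that corners lie in \<open>k e\<^sub>i + B\<close>: the scalar
  is represented by an element \<open>c\<close> of \<open>B\<close> commuting with
  \<open>e i\<close>.\<close>

locale triangular_extension = A: ring A
  for A :: "'a ring" +
  fixes B :: "'a set" and J :: "nat set" and e :: "nat \<Rightarrow> 'a"
  assumes B_subring: "subring B A"
    and finite_J: "finite J"
    and e_closed: "i \<in> J \<Longrightarrow> e i \<in> carrier A"
    and e_idem: "i \<in> J \<Longrightarrow> e i \<otimes>\<^bsub>A\<^esub> e i = e i"
    and e_orth: "\<lbrakk>i \<in> J; j \<in> J; i \<noteq> j\<rbrakk> \<Longrightarrow> e i \<otimes>\<^bsub>A\<^esub> e j = \<zero>\<^bsub>A\<^esub>"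
    and e_sum: "(\<Oplus>\<^bsub>A\<^esub>i\<in>J. e i) = \<one>\<^bsub>A\<^esub>"
    and triangular: "\<lbrakk>i \<in> J; j \<in> J; j < i; a \<in> carrier A\<rbrakk> \<Longrightarrow> e i \<otimes>\<^bsub>A\<^esub> a \<otimes>\<^bsub>A\<^esub> e j = \<zero>\<^bsub>A\<^esub>"
    and off_diagonal: "\<lbrakk>i \<in> J; j \<in> J; i \<noteq> j; b \<in> B\<rbrakk> \<Longrightarrow> e i \<otimes>\<^bsub>A\<^esub> b \<otimes>\<^bsub>A\<^esub> e j \<in> B"
    and diagonal: "\<lbrakk>i \<in> J; a \<in> carrier A\<rbrakk> \<Longrightarrow>
      \<exists>c\<in>B. \<exists>r\<in>B. c \<otimes>\<^bsub>A\<^esub> e i = e i \<otimes>\<^bsub>A\<^esub> c \<and> e i \<otimes>\<^bsub>A\<^esub> a \<otimes>\<^bsub>A\<^esub> e i = c \<otimes>\<^bsub>A\<^esub> e i \<oplus>\<^bsub>A\<^esub> r"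

locale triangular_extension_module = triangular_extension A B J e + M: left_module A M
  for A :: "'a ring" and B J e and M :: "('a, 'm) module"
begin

lemma B_carrier: "b \<in> B \<Longrightarrow> b \<in> carrier A"
  using subringE(1)[OF B_subring] by blast

sublocale tensor_product A B M
  by unfold_locales (auto intro: B_carrier M.smult_closed)

text \<open>A corner crosses the tensor sign although \<open>e i\<close> itself may not. Off the
  diagonal the corner is in \<open>B\<close>. On the diagonal it is \<open>c e\<^sub>i + r\<close>,
  and since \<open>e i\<close> is already present on both sides only \<open>c\<close> and
  \<open>r\<close>, which are in \<open>B\<close>, have to move.\<close>

lemma tens_corner:
  assumes i: "i \<in> J" and j: "j \<in> J" and a: "a \<in> carrier A" and u: "u \<in> carrier A"
    and m: "m \<in> carrier M" and ij: "i = j \<or> a \<in> B"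
  defines "x \<equiv> e j \<otimes>\<^bsub>A\<^esub> a \<otimes>\<^bsub>A\<^esub> e i"
  shows "tens (u \<otimes>\<^bsub>A\<^esub> x) (e i \<odot>\<^bsub>M\<^esub> m) = tens (u \<otimes>\<^bsub>A\<^esub> e j) (x \<odot>\<^bsub>M\<^esub> m)"
proof -
  have x: "x \<in> carrier A" and xe: "x \<otimes>\<^bsub>A\<^esub> e i = x" and ex: "e j \<otimes>\<^bsub>A\<^esub> x = x"
    using i j a e_closed e_idem by (auto simp: x_def A.m_assoc) (metis A.m_assoc e_closed e_idem A.m_closed)+
  have ei: "e i \<in> carrier A" and ej: "e j \<in> carrier A" and em: "e i \<odot>\<^bsub>M\<^esub> m \<in> carrier M"
    using i j m e_closed M.smult_closed by auto
  show ?thesis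
  proof (cases "i = j")
    case False
    then have "x \<in> B" using ij off_diagonal i j by (auto simp: x_def)
    have "tens (u \<otimes>\<^bsub>A\<^esub> x) (e i \<odot>\<^bsub>M\<^esub> m) = tens (u \<otimes>\<^bsub>A\<^esub> e j \<otimes>\<^bsub>A\<^esub> x) (e i \<odot>\<^bsub>M\<^esub> m)"
      using u x ej ex by (simp add: A.m_assoc)
    also have "\<dots> = tens (u \<otimes>\<^bsub>A\<^esub> e j) (x \<odot>\<^bsub>M\<^esub> (e i \<odot>\<^bsub>M\<^esub> m))"
      using u ej em \<open>x \<in> B\<close> by (intro tens_balanced) auto
    finally show ?thesis
      using m x ei xe by (simp add: M.smult_assoc[symmetric])
  next
    case True
    obtain c r where c: "c \<in> B" "r \<in> B" "c \<otimes>\<^bsub>A\<^esub> e i = e i \<otimes>\<^bsub>A\<^esub> c" "x = c \<otimes>\<^bsub>A\<^esub> e i \<oplus>\<^bsub>A\<^esub> r"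
      using diagonal[OF i a] True unfolding x_def by blast
    have cr: "c \<in> carrier A" "r \<in> carrier A" using c B_carrier by auto
    \<comment> \<open>On the left the factor \<open>e i\<close> is put in front of \<open>c\<close>
      and \<open>r\<close>, by means of \<open>x = e\<^sub>i x\<close>, so that they stand next to
      the tensor sign.\<close>
    have "u \<otimes>\<^bsub>A\<^esub> x = u \<otimes>\<^bsub>A\<^esub> (e i \<otimes>\<^bsub>A\<^esub> (e i \<otimes>\<^bsub>A\<^esub> c \<oplus>\<^bsub>A\<^esub> r))"
      using ex True c by metis
    also have "\<dots> = u \<otimes>\<^bsub>A\<^esub> e i \<otimes>\<^bsub>A\<^esub> c \<oplus>\<^bsub>A\<^esub> u \<otimes>\<^bsub>A\<^esub> e i \<otimes>\<^bsub>A\<^esub> r"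
      using cr u ei e_idem[OF i] by (simp add: A.r_distr A.m_assoc) (metis A.m_assoc)
    finally have "tens (u \<otimes>\<^bsub>A\<^esub> x) (e i \<odot>\<^bsub>M\<^esub> m) =
        tens (u \<otimes>\<^bsub>A\<^esub> e i \<otimes>\<^bsub>A\<^esub> c) (e i \<odot>\<^bsub>M\<^esub> m) \<oplus>\<^bsub>T\<^esub> tens (u \<otimes>\<^bsub>A\<^esub> e i \<otimes>\<^bsub>A\<^esub> r) (e i \<odot>\<^bsub>M\<^esub> m)"
      using u ei cr em by (simp add: tens_l_add)
    also have "\<dots> = tens (u \<otimes>\<^bsub>A\<^esub> e i) (c \<odot>\<^bsub>M\<^esub> (e i \<odot>\<^bsub>M\<^esub> m)) \<oplus>\<^bsub>T\<^esub> tens (u \<otimes>\<^bsub>A\<^esub> e i) (r \<odot>\<^bsub>M\<^esub> (e i \<odot>\<^bsub>M\<^esub> m))"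
      using u ei c em by (simp add: tens_balanced)
    also have "\<dots> = tens (u \<otimes>\<^bsub>A\<^esub> e i) (c \<odot>\<^bsub>M\<^esub> (e i \<odot>\<^bsub>M\<^esub> m) \<oplus>\<^bsub>M\<^esub> r \<odot>\<^bsub>M\<^esub> (e i \<odot>\<^bsub>M\<^esub> m))"
      using u ei cr em by (simp add: tens_r_add M.smult_closed)
    also have "c \<odot>\<^bsub>M\<^esub> (e i \<odot>\<^bsub>M\<^esub> m) \<oplus>\<^bsub>M\<^esub> r \<odot>\<^bsub>M\<^esub> (e i \<odot>\<^bsub>M\<^esub> m) = x \<odot>\<^bsub>M\<^esub> (e i \<odot>\<^bsub>M\<^esub> m)"
    proof -
      \<comment> \<open>On the right \<open>e i\<close> already acts on \<open>m\<close>, and after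
        it \<open>x\<close> acts like \<open>c + r\<close>.\<close>
      have "x \<otimes>\<^bsub>A\<^esub> e i = (c \<oplus>\<^bsub>A\<^esub> r) \<otimes>\<^bsub>A\<^esub> e i"
        using c(4) cr ei e_idem[OF i] by (simp add: A.l_distr A.m_assoc)
      then have "x \<odot>\<^bsub>M\<^esub> (e i \<odot>\<^bsub>M\<^esub> m) = (c \<oplus>\<^bsub>A\<^esub> r) \<odot>\<^bsub>M\<^esub> (e i \<odot>\<^bsub>M\<^esub> m)"
        using x ei cr m by (simp add: M.smult_assoc[symmetric])
      then show ?thesis using cr em by (simp add: M.smult_l_distr)
    qed
    also have "x \<odot>\<^bsub>M\<^esub> (e i \<odot>\<^bsub>M\<^esub> m) = x \<odot>\<^bsub>M\<^esub> m"
      using m x ei xe by (simp add: M.smult_assoc[symmetric])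
    finally show ?thesis using True by simp
  qed
qed

lemma tens_finsum_l:
  assumes "m \<in> carrier M" "f \<in> S \<rightarrow> carrier A"
  shows "tens (\<Oplus>\<^bsub>A\<^esub>i\<in>S. f i) m = (\<Oplus>\<^bsub>T\<^esub>i\<in>S. tens (f i) m)"
  using assms
  by (intro hom_finsum[OF A.abelian_group_axioms T.M.abelian_group_axioms, of "\<lambda>a. tens a m"])
    (auto simp: hom_def tens_l_add)

lemma tens_finsum_r:
  assumes "a \<in> carrier A" "f \<in> S \<rightarrow> carrier M"
  shows "tens a (\<Oplus>\<^bsub>M\<^esub>i\<in>S. f i) = (\<Oplus>\<^bsub>T\<^esub>i\<in>S. tens a (f i))"
  using assms
  by (intro hom_finsum[OF M.M.abelian_group_axioms T.M.abelian_group_axioms, of "\<lambda>v. tens a v"])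
    (auto simp: hom_def tens_r_add)

lemma e_smult_sum:
  assumes "m \<in> carrier M"
  shows "(\<Oplus>\<^bsub>M\<^esub>i\<in>J. e i \<odot>\<^bsub>M\<^esub> m) = m"
  using assms M.finsum_smult[of m e "J"] e_closed e_sum by (simp add: M.smult_one)

lemma e_mult_sum:
  assumes "a \<in> carrier A"
  shows "(\<Oplus>\<^bsub>A\<^esub>i\<in>J. a \<otimes>\<^bsub>A\<^esub> e i) = a" "(\<Oplus>\<^bsub>A\<^esub>i\<in>J. e i \<otimes>\<^bsub>A\<^esub> a) = a"
proof -
  have "e \<in> J \<rightarrow> carrier A" using e_closed by blast
  then show "(\<Oplus>\<^bsub>A\<^esub>i\<in>J. a \<otimes>\<^bsub>A\<^esub> e i) = a" "(\<Oplus>\<^bsub>A\<^esub>i\<in>J. e i \<otimes>\<^bsub>A\<^esub> a) = a"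
    using A.finsum_rdistr[of "J" a e] A.finsum_ldistr[of "J" a e] assms e_sum finite_J by simp_all
qed

text \<open>The value at \<open>a \<otimes> m\<close> of the idempotent endomorphism. The sum does
  not change when some \<open>e j\<close> is moved across the tensor sign, which is how balancing
  over the \<open>e j\<close> is imposed inside the tensor product over \<open>B\<close>.\<close>

definition split_tens :: "'a \<Rightarrow> 'm \<Rightarrow> ('a \<times> 'm \<Rightarrow>\<^sub>0 int) set" where
  "split_tens a m = (\<Oplus>\<^bsub>T\<^esub>i\<in>J. tens (a \<otimes>\<^bsub>A\<^esub> e i) (e i \<odot>\<^bsub>M\<^esub> m))"

lemma split_tens_term_closed:
  "\<lbrakk>a \<in> carrier A; m \<in> carrier M; i \<in> J\<rbrakk> \<Longrightarrow> tens (a \<otimes>\<^bsub>A\<^esub> e i) (e i \<odot>\<^bsub>M\<^esub> m) \<in> carrier T"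
  using e_closed M.smult_closed by simp

lemma split_tens_closed: "a \<in> carrier A \<Longrightarrow> m \<in> carrier M \<Longrightarrow> split_tens a m \<in> carrier T"
  unfolding split_tens_def using split_tens_term_closed by (intro T.M.finsum_closed) blast

lemma split_tens_l_add:
  assumes "a \<in> carrier A" "a' \<in> carrier A" "m \<in> carrier M"
  shows "split_tens (a \<oplus>\<^bsub>A\<^esub> a') m = split_tens a m \<oplus>\<^bsub>T\<^esub> split_tens a' m"
proof -
  have "split_tens (a \<oplus>\<^bsub>A\<^esub> a') m = (\<Oplus>\<^bsub>T\<^esub>i\<in>J.
      tens (a \<otimes>\<^bsub>A\<^esub> e i) (e i \<odot>\<^bsub>M\<^esub> m) \<oplus>\<^bsub>T\<^esub> tens (a' \<otimes>\<^bsub>A\<^esub> e i) (e i \<odot>\<^bsub>M\<^esub> m))"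
    unfolding split_tens_def using assms e_closed M.smult_closed
    by (intro T.M.finsum_cong') (auto simp: A.l_distr tens_l_add)
  then show ?thesis
    unfolding split_tens_def using assms split_tens_term_closed
    by (simp add: T.M.finsum_addf Pi_iff)
qed

lemma split_tens_r_add:
  assumes "a \<in> carrier A" "m \<in> carrier M" "m' \<in> carrier M"
  shows "split_tens a (m \<oplus>\<^bsub>M\<^esub> m') = split_tens a m \<oplus>\<^bsub>T\<^esub> split_tens a m'"
proof -
  have "split_tens a (m \<oplus>\<^bsub>M\<^esub> m') = (\<Oplus>\<^bsub>T\<^esub>i\<in>J.
      tens (a \<otimes>\<^bsub>A\<^esub> e i) (e i \<odot>\<^bsub>M\<^esub> m) \<oplus>\<^bsub>T\<^esub> tens (a \<otimes>\<^bsub>A\<^esub> e i) (e i \<odot>\<^bsub>M\<^esub> m'))"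
    unfolding split_tens_def using assms e_closed M.smult_closed
    by (intro T.M.finsum_cong') (auto simp: M.smult_r_distr tens_r_add)
  then show ?thesis
    unfolding split_tens_def using assms split_tens_term_closed
    by (simp add: T.M.finsum_addf Pi_iff)
qed

text \<open>Cut \<open>b\<close> into its corners \<open>e\<^sub>j b e\<^sub>i\<close>, let each
  cross by \<open>tens_corner\<close>, and sum up again in the other order: over \<open>j\<close> to
  recover \<open>b e\<^sub>i\<close> on the left, over \<open>i\<close> to recover
  \<open>e\<^sub>j b\<close> on the right.\<close>

lemma split_tens_balanced:
  assumes a: "a \<in> carrier A" and b: "b \<in> B" and m: "m \<in> carrier M"
  shows "split_tens (a \<otimes>\<^bsub>A\<^esub> b) m = split_tens a (b \<odot>\<^bsub>M\<^esub> m)"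
proof -
  have bA: "b \<in> carrier A" using b by (rule B_carrier)
  define x where "x i j = e j \<otimes>\<^bsub>A\<^esub> b \<otimes>\<^bsub>A\<^esub> e i" for i j
  have x: "x i j \<in> carrier A" if "i \<in> J" "j \<in> J" for i j
    using that bA e_closed by (simp add: x_def)
  have "split_tens (a \<otimes>\<^bsub>A\<^esub> b) m = (\<Oplus>\<^bsub>T\<^esub>i\<in>J. \<Oplus>\<^bsub>T\<^esub>j\<in>J. tens (a \<otimes>\<^bsub>A\<^esub> x i j) (e i \<odot>\<^bsub>M\<^esub> m))"
    unfolding split_tens_def
  proof (rule T.M.finsum_cong', goal_cases)
    case (3 i)
    have "a \<otimes>\<^bsub>A\<^esub> b \<otimes>\<^bsub>A\<^esub> e i = a \<otimes>\<^bsub>A\<^esub> (\<Oplus>\<^bsub>A\<^esub>j\<in>J. e j \<otimes>\<^bsub>A\<^esub> (b \<otimes>\<^bsub>A\<^esub> e i))"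
      using 3 a bA e_closed by (simp add: A.m_assoc e_mult_sum)
    also have "\<dots> = (\<Oplus>\<^bsub>A\<^esub>j\<in>J. a \<otimes>\<^bsub>A\<^esub> (e j \<otimes>\<^bsub>A\<^esub> (b \<otimes>\<^bsub>A\<^esub> e i)))"
      using 3 a bA e_closed by (intro A.finsum_rdistr finite_J) auto
    also have "\<dots> = (\<Oplus>\<^bsub>A\<^esub>j\<in>J. a \<otimes>\<^bsub>A\<^esub> x i j)"
      using 3 a bA e_closed by (intro A.finsum_cong') (auto simp: x_def A.m_assoc)
    finally show ?case
      using 3 a x m e_closed by (simp add: tens_finsum_l M.smult_closed Pi_iff)
  qed (use a m x e_closed in \<open>auto simp: M.smult_closed intro!: T.M.finsum_closed\<close>)
  also have "\<dots> = (\<Oplus>\<^bsub>T\<^esub>i\<in>J. \<Oplus>\<^bsub>T\<^esub>j\<in>J. tens (a \<otimes>\<^bsub>A\<^esub> e j) (x i j \<odot>\<^bsub>M\<^esub> m))"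
  proof (intro T.M.finsum_cong', goal_cases)
    case (5 i j)
    then show ?case unfolding x_def using a bA b m by (intro tens_corner) auto
  qed (use a m x e_closed in \<open>auto simp: M.smult_closed intro!: T.M.finsum_closed\<close>)
  also have "\<dots> = (\<Oplus>\<^bsub>T\<^esub>j\<in>J. \<Oplus>\<^bsub>T\<^esub>i\<in>J. tens (a \<otimes>\<^bsub>A\<^esub> e j) (x i j \<odot>\<^bsub>M\<^esub> m))"
    using a m x e_closed by (intro T.M.finsum_exchange finite_J) (auto simp: M.smult_closed)
  also have "\<dots> = split_tens a (b \<odot>\<^bsub>M\<^esub> m)"
    unfolding split_tens_def
  proof (rule T.M.finsum_cong', goal_cases)
    case (3 j)
    have "e j \<odot>\<^bsub>M\<^esub> (b \<odot>\<^bsub>M\<^esub> m) = (\<Oplus>\<^bsub>A\<^esub>i\<in>J. (e j \<otimes>\<^bsub>A\<^esub> b) \<otimes>\<^bsub>A\<^esub> e i) \<odot>\<^bsub>M\<^esub> m"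
      using 3 m bA e_closed by (simp add: M.smult_assoc e_mult_sum)
    also have "\<dots> = (\<Oplus>\<^bsub>M\<^esub>i\<in>J. x i j \<odot>\<^bsub>M\<^esub> m)"
      using 3 m bA e_closed by (subst M.finsum_smult) (auto simp: x_def)
    finally show ?case
      using 3 a x m e_closed by (simp add: tens_finsum_r M.smult_closed Pi_iff)
  qed (use a m x bA e_closed in \<open>auto simp: M.smult_closed intro!: T.M.finsum_closed\<close>)
  finally show ?thesis .
qed

lemma split_tens_smult:
  assumes "a \<in> carrier A" "c \<in> carrier A" "m \<in> carrier M"
  shows "split_tens (a \<otimes>\<^bsub>A\<^esub> c) m = a \<odot>\<^bsub>T\<^esub> split_tens c m"
proof -
  have "a \<odot>\<^bsub>T\<^esub> split_tens c m = (\<Oplus>\<^bsub>T\<^esub>i\<in>J. a \<odot>\<^bsub>T\<^esub> tens (c \<otimes>\<^bsub>A\<^esub> e i) (e i \<odot>\<^bsub>M\<^esub> m))"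
    unfolding split_tens_def using assms split_tens_term_closed by (intro T.smult_finsum) auto
  also have "\<dots> = split_tens (a \<otimes>\<^bsub>A\<^esub> c) m"
    unfolding split_tens_def using assms e_closed
    by (intro T.M.finsum_cong') (auto simp: smult_tens M.smult_closed A.m_assoc)
  finally show ?thesis by simp
qed

text \<open>By orthogonality only the summand at \<open>i\<close> survives. As
  \<open>split_tens\<close> is a sum of such tensors, the endomorphism it defines is
  idempotent.\<close>

lemma split_tens_corner:
  assumes "a \<in> carrier A" "m \<in> carrier M" "i \<in> J"
  shows "split_tens (a \<otimes>\<^bsub>A\<^esub> e i) (e i \<odot>\<^bsub>M\<^esub> m) = tens (a \<otimes>\<^bsub>A\<^esub> e i) (e i \<odot>\<^bsub>M\<^esub> m)"
proof -
  have "tens (a \<otimes>\<^bsub>A\<^esub> e i \<otimes>\<^bsub>A\<^esub> e j) (e j \<odot>\<^bsub>M\<^esub> (e i \<odot>\<^bsub>M\<^esub> m)) = \<zero>\<^bsub>T\<^esub>"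
    if "j \<in> J" "j \<noteq> i" for j
  proof -
    have "e j \<odot>\<^bsub>M\<^esub> (e i \<odot>\<^bsub>M\<^esub> m) = \<zero>\<^bsub>M\<^esub>"
      using that assms e_closed e_orth[of j i] by (simp add: M.smult_assoc[symmetric] M.smult_l_null)
    moreover have "tens u \<zero>\<^bsub>M\<^esub> = \<zero>\<^bsub>T\<^esub>" if "u \<in> carrier A" for u
      using tens_finsum_r[of u "\<lambda>_. \<zero>\<^bsub>M\<^esub>" "{}"] that by simp
    ultimately show ?thesis using that assms e_closed by simp
  qed
  then have "split_tens (a \<otimes>\<^bsub>A\<^esub> e i) (e i \<odot>\<^bsub>M\<^esub> m) =
      tens (a \<otimes>\<^bsub>A\<^esub> e i \<otimes>\<^bsub>A\<^esub> e i) (e i \<odot>\<^bsub>M\<^esub> (e i \<odot>\<^bsub>M\<^esub> m))"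
    unfolding split_tens_def using assms e_closed
    by (intro T.M.finsum_delta finite_J) (auto simp: M.smult_closed)
  then show ?thesis
    using assms e_closed e_idem by (simp add: M.smult_assoc[symmetric] A.m_assoc)
qed

end

section \<open>The relatively projective cover and the support of its kernel\<close>

context triangular_extension_module
begin

lemma split_exists:
  obtains \<pi> where "\<pi> \<in> module_hom A T T"
    "\<And>a m. a \<in> carrier A \<Longrightarrow> m \<in> carrier M \<Longrightarrow> \<pi> (tens a m) = split_tens a m"
  by (rule T_universal_module[OF T_left_module split_tens_closed split_tens_l_add split_tens_r_add
        split_tens_balanced split_tens_smult]) (assumption | rule that, assumption, blast)+

lemma action_exists:
  obtains \<mu> where "\<mu> \<in> module_hom A T M"
    "\<And>a m. a \<in> carrier A \<Longrightarrow> m \<in> carrier M \<Longrightarrow> \<mu> (tens a m) = a \<odot>\<^bsub>M\<^esub> m"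
  by (rule T_universal_module[OF M.left_module_axioms, of "\<lambda>a m. a \<odot>\<^bsub>M\<^esub> m"])
    (simp_all add: that M.smult_closed M.smult_l_distr M.smult_r_distr M.smult_assoc B_carrier)

text \<open>The cover \<open>P\<close> is the image of the idempotent \<open>\<pi>\<close>, copied
  into the type of \<open>M\<close>; \<open>d\<close> is the action map and \<open>s\<close> sends
  \<open>m\<close> to the copy of \<open>split_tens\<close> at \<open>1\<close> and
  \<open>m\<close>. The last conclusion drives the induction: at a vertex above which
  \<open>M\<close> vanishes, the kernel of \<open>d\<close> vanishes too.\<close>

lemma relative_cover:
  fixes \<iota> :: "'a \<Rightarrow> 'm"
  assumes "infinite (UNIV :: 'm set)" "inj_on \<iota> (carrier A)"
  obtains P :: "('a, 'm) module" and d s where "rel_projective A B P"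
    "d \<in> module_hom A P M" "s \<in> module_hom (A\<lparr>carrier := B\<rparr>) M P"
    "\<And>m. m \<in> carrier M \<Longrightarrow> d (s m) = m"
    "\<And>i x. \<lbrakk>i \<in> J; \<And>j m. j \<in> J \<Longrightarrow> i < j \<Longrightarrow> m \<in> carrier M \<Longrightarrow> e j \<odot>\<^bsub>M\<^esub> m = \<zero>\<^bsub>M\<^esub>;
        x \<in> carrier P; d x = \<zero>\<^bsub>M\<^esub>\<rbrakk> \<Longrightarrow> e i \<odot>\<^bsub>P\<^esub> x = \<zero>\<^bsub>P\<^esub>"
proof -
  obtain \<phi> :: "('a \<times> 'm \<Rightarrow>\<^sub>0 int) set \<Rightarrow> 'm" where \<phi>: "inj_on \<phi> (carrier T)"
    using T_lepoll[OF assms] by blast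
  obtain \<pi> where \<pi>: "\<pi> \<in> module_hom A T T"
    "\<And>a m. a \<in> carrier A \<Longrightarrow> m \<in> carrier M \<Longrightarrow> \<pi> (tens a m) = split_tens a m"
    using split_exists by blast
  obtain \<mu> where \<mu>: "\<mu> \<in> module_hom A T M"
    "\<And>a m. a \<in> carrier A \<Longrightarrow> m \<in> carrier M \<Longrightarrow> \<mu> (tens a m) = a \<odot>\<^bsub>M\<^esub> m"
    using action_exists by blast
  note \<pi>_hom = module_homD[OF \<pi>(1)] and \<mu>_hom = module_homD[OF \<mu>(1)]
  have tcl: "(\<lambda>i. tens (a \<otimes>\<^bsub>A\<^esub> e i) (e i \<odot>\<^bsub>M\<^esub> m)) \<in> J \<rightarrow> carrier T"
    if "a \<in> carrier A" "m \<in> carrier M" for a m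
    using split_tens_term_closed that by blast
  have \<pi>_split: "\<pi> (split_tens a m) = split_tens a m" if "a \<in> carrier A" "m \<in> carrier M" for a m
  proof -
    have "\<pi> (split_tens a m) = (\<Oplus>\<^bsub>T\<^esub>i\<in>J. \<pi> (tens (a \<otimes>\<^bsub>A\<^esub> e i) (e i \<odot>\<^bsub>M\<^esub> m)))"
      unfolding split_tens_def
      by (rule hom_finsum[OF T.M.abelian_group_axioms T.M.abelian_group_axioms module_hom_hom[OF \<pi>(1)] tcl[OF that]])
    also have "\<dots> = split_tens a m"
      unfolding split_tens_def using that e_closed split_tens_term_closed
      by (intro T.M.finsum_cong') (auto simp: \<pi>(2) M.smult_closed split_tens_corner)
    finally show ?thesis .
  qed
  have \<mu>_split: "\<mu> (split_tens a m) = a \<odot>\<^bsub>M\<^esub> m" if "a \<in> carrier A" "m \<in> carrier M" for a m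
  proof -
    have "\<mu> (split_tens a m) = (\<Oplus>\<^bsub>M\<^esub>i\<in>J. \<mu> (tens (a \<otimes>\<^bsub>A\<^esub> e i) (e i \<odot>\<^bsub>M\<^esub> m)))"
      unfolding split_tens_def
      by (rule hom_finsum[OF T.M.abelian_group_axioms M.M.abelian_group_axioms module_hom_hom[OF \<mu>(1)] tcl[OF that]])
    also have "\<dots> = (\<Oplus>\<^bsub>M\<^esub>i\<in>J. a \<odot>\<^bsub>M\<^esub> (e i \<odot>\<^bsub>M\<^esub> m))"
      using that e_closed e_idem
      by (intro M.M.finsum_cong') (auto simp: \<mu>(2) M.smult_closed M.smult_assoc[symmetric] A.m_assoc)
    also have "\<dots> = a \<odot>\<^bsub>M\<^esub> m"
      using that e_closed M.smult_finsum[of a "\<lambda>i. e i \<odot>\<^bsub>M\<^esub> m" J] by (simp add: M.smult_closed e_smult_sum Pi_iff)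
    finally show ?thesis .
  qed
  have \<pi>\<pi>: "\<pi> (\<pi> t) = \<pi> t" if "t \<in> carrier T" for t
  proof (rule T_hom_eqI[OF T.M.abelian_group_axioms _ module_hom_hom[OF \<pi>(1)] _ that, of "\<lambda>t. \<pi> (\<pi> t)"])
    show "(\<lambda>t. \<pi> (\<pi> t)) \<in> hom (add_monoid T) (add_monoid T)"
      by (simp add: hom_def \<pi>_hom)
  qed (simp add: \<pi>(2) \<pi>_split)
  \<comment> \<open>The right side depends on \<open>t\<close> only through \<open>\<mu> t\<close>:
    at such a vertex an element of the image of \<open>\<pi>\<close> is determined by its image in
    \<open>M\<close>.\<close>
  have corner: "e i \<odot>\<^bsub>T\<^esub> \<pi> t = tens (e i) (e i \<odot>\<^bsub>M\<^esub> \<mu> t)"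
    if i: "i \<in> J" and supp: "\<And>j m. j \<in> J \<Longrightarrow> i < j \<Longrightarrow> m \<in> carrier M \<Longrightarrow> e j \<odot>\<^bsub>M\<^esub> m = \<zero>\<^bsub>M\<^esub>"
      and t: "t \<in> carrier T" for i t
  proof (rule T_hom_eqI[OF T.M.abelian_group_axioms _ _ _ t,
        of "\<lambda>t. e i \<odot>\<^bsub>T\<^esub> \<pi> t" "\<lambda>t. tens (e i) (e i \<odot>\<^bsub>M\<^esub> \<mu> t)"])
    have ei: "e i \<in> carrier A" using i by (rule e_closed)
    show "(\<lambda>t. e i \<odot>\<^bsub>T\<^esub> \<pi> t) \<in> hom (add_monoid T) (add_monoid T)"
      using ei by (auto simp: hom_def \<pi>_hom T.smult_closed T.smult_r_distr)
    show "(\<lambda>t. tens (e i) (e i \<odot>\<^bsub>M\<^esub> \<mu> t)) \<in> hom (add_monoid T) (add_monoid T)"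
      using ei by (auto simp: hom_def \<mu>_hom M.smult_closed M.smult_r_distr tens_r_add)
    show "e i \<odot>\<^bsub>T\<^esub> \<pi> (tens a m) = tens (e i) (e i \<odot>\<^bsub>M\<^esub> \<mu> (tens a m))"
      if a: "a \<in> carrier A" and m: "m \<in> carrier M" for a m
    proof -
      have tens0: "tens u \<zero>\<^bsub>M\<^esub> = \<zero>\<^bsub>T\<^esub>" "tens \<zero>\<^bsub>A\<^esub> v = \<zero>\<^bsub>T\<^esub>"
        if "u \<in> carrier A" "v \<in> carrier M" for u v
        using tens_finsum_r[of u "\<lambda>_. \<zero>\<^bsub>M\<^esub>" "{}"] tens_finsum_l[of v "\<lambda>_. \<zero>\<^bsub>A\<^esub>" "{}"] that by simp_all
      \<comment> \<open>For \<open>j < i\<close> triangularity kills the corner of \<open>A\<close>;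
        for \<open>j > i\<close> the support condition kills the corner of \<open>M\<close>.\<close>
      have vanish: "e i \<otimes>\<^bsub>A\<^esub> a \<otimes>\<^bsub>A\<^esub> e j = \<zero>\<^bsub>A\<^esub> \<or> e j \<odot>\<^bsub>M\<^esub> m = \<zero>\<^bsub>M\<^esub>" if "j \<in> J" "j \<noteq> i" for j
        using that i a m triangular supp by (metis linorder_neqE)
      have "e i \<odot>\<^bsub>T\<^esub> \<pi> (tens a m) = split_tens (e i \<otimes>\<^bsub>A\<^esub> a) m"
        using a m ei by (simp add: \<pi>(2) split_tens_smult)
      also have "\<dots> = tens (e i \<otimes>\<^bsub>A\<^esub> a \<otimes>\<^bsub>A\<^esub> e i) (e i \<odot>\<^bsub>M\<^esub> m)"
      proof (unfold split_tens_def, rule T.M.finsum_delta[OF finite_J i])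
        show "tens (e i \<otimes>\<^bsub>A\<^esub> a \<otimes>\<^bsub>A\<^esub> e j) (e j \<odot>\<^bsub>M\<^esub> m) = \<zero>\<^bsub>T\<^esub>" if "j \<in> J" "j \<noteq> i" for j
          using vanish[OF that] that a m ei e_closed by (auto simp: tens0 M.smult_closed)
      qed (use a m ei in \<open>simp add: M.smult_closed\<close>)
      \<comment> \<open>The unit is inserted to play the role of \<open>u\<close> in
        \<open>tens_corner\<close>, which is applied with both indices equal to
        \<open>i\<close>.\<close>
      also have "\<dots> = tens (\<one>\<^bsub>A\<^esub> \<otimes>\<^bsub>A\<^esub> (e i \<otimes>\<^bsub>A\<^esub> a \<otimes>\<^bsub>A\<^esub> e i)) (e i \<odot>\<^bsub>M\<^esub> m)"
        using a ei by simp
      also have "\<dots> = tens (\<one>\<^bsub>A\<^esub> \<otimes>\<^bsub>A\<^esub> e i) ((e i \<otimes>\<^bsub>A\<^esub> a \<otimes>\<^bsub>A\<^esub> e i) \<odot>\<^bsub>M\<^esub> m)"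
        using i a m by (intro tens_corner) auto
      \<comment> \<open>The vanishing summands \<open>j \<noteq> i\<close> are put back, because the
        full sum over \<open>j\<close> adds up to \<open>e\<^sub>i a m\<close>.\<close>
      also have "(e i \<otimes>\<^bsub>A\<^esub> a \<otimes>\<^bsub>A\<^esub> e i) \<odot>\<^bsub>M\<^esub> m = (\<Oplus>\<^bsub>M\<^esub>j\<in>J. (e i \<otimes>\<^bsub>A\<^esub> a \<otimes>\<^bsub>A\<^esub> e j) \<odot>\<^bsub>M\<^esub> m)"
      proof (rule M.M.finsum_delta[OF finite_J i, symmetric])
        show "(e i \<otimes>\<^bsub>A\<^esub> a \<otimes>\<^bsub>A\<^esub> e j) \<odot>\<^bsub>M\<^esub> m = \<zero>\<^bsub>M\<^esub>" if "j \<in> J" "j \<noteq> i" for j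
          using vanish[OF that] that a m ei e_closed
          by (auto simp: M.smult_l_null) (simp add: M.smult_assoc M.smult_r_null)
      qed (use a m ei in \<open>simp add: M.smult_closed\<close>)
      also have "\<dots> = e i \<odot>\<^bsub>M\<^esub> (a \<odot>\<^bsub>M\<^esub> m)"
        using a m ei e_closed M.finsum_smult[of m "\<lambda>j. e i \<otimes>\<^bsub>A\<^esub> a \<otimes>\<^bsub>A\<^esub> e j" J]
        by (simp add: e_mult_sum M.smult_assoc[symmetric] Pi_iff)
      finally show ?thesis using a m ei by (simp add: \<mu>(2))
    qed
  qed
  define N where "N = \<pi> ` carrier T"
  have N_iff: "t \<in> N \<longleftrightarrow> t \<in> carrier T \<and> \<pi> t = t" for t
  proof
    assume "t \<in> N"
    then obtain u where u: "u \<in> carrier T" "t = \<pi> u" unfolding N_def by blast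
    then show "t \<in> carrier T \<and> \<pi> t = t" using \<pi>_hom(1)[OF u(1)] \<pi>\<pi>[OF u(1)] by simp
  next
    assume "t \<in> carrier T \<and> \<pi> t = t"
    then have "t \<in> carrier T" "t = \<pi> t" by simp_all
    then show "t \<in> N" unfolding N_def by (rule rev_image_eqI)
  qed
  have N_sub: "submodule N A T"
    unfolding N_def by (rule submodule_image[OF T_left_module T_left_module \<pi>(1)])
  define TN where "TN = T\<lparr>carrier := N\<rparr>"
  have TN: "left_module A TN" unfolding TN_def by (rule left_module_submodule[OF T_left_module N_sub])
  have N_summand: "direct_summand A T N"
  proof -
    \<comment> \<open>The inclusion of \<open>N\<close> is a section of \<open>\<pi>\<close>,
      regarded as a map onto its image.\<close>
    have "direct_summand A T ((\<lambda>t. t) ` carrier TN)"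
      by (rule direct_summand_section(2)[OF T_left_module TN, of \<pi>])
        (use \<pi>_hom \<pi>\<pi> in \<open>auto simp: module_hom_def TN_def N_iff\<close>)
    then show ?thesis by (simp add: TN_def)
  qed
  have \<phi>_inj: "inj_on \<phi> (carrier TN)"
    using \<phi> by (rule inj_on_subset) (auto simp: TN_def N_iff)
  define P where "P = transport \<phi> TN"
  define \<psi> where "\<psi> = the_inv_into (carrier TN) \<phi>"
  have P: "left_module A P" and \<psi>: "\<psi> \<in> module_iso A P TN"
    unfolding P_def \<psi>_def using transport_props[OF TN \<phi>_inj] by auto
  interpret P: left_module A P by (rule P)
  interpret TN: left_module A TN by (rule TN)
  have \<psi>_hom: "\<psi> \<in> module_hom A P TN" and \<psi>_bij: "bij_betw \<psi> (carrier P) (carrier TN)"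
    using \<psi> by (auto simp: module_iso_def)
  note \<psi>D = module_homD[OF \<psi>_hom]
  have \<psi>\<phi>: "\<psi> (\<phi> t) = t" "\<phi> t \<in> carrier P" if "t \<in> carrier TN" for t
    using that the_inv_into_f_f[OF \<phi>_inj] by (auto simp: \<psi>_def P_def transport_def)
  have \<phi>\<psi>: "\<phi> (\<psi> x) = x" if "x \<in> carrier P" for x
    using that \<psi>\<phi> by (auto simp: P_def transport_def)
  \<comment> \<open>The \<open>B\<close>-module inducing the tensor product is \<open>M\<close>
    itself with scalars restricted to \<open>B\<close>.\<close>
  have proj: "rel_projective A B P"
    unfolding rel_projective_def
    using P left_module_restrict_ring[OF M.left_module_axioms B_subring] N_summand \<psi>
    by (auto simp: TN_def)
  define d where "d x = \<mu> (\<psi> x)" for x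
  define s where "s m = \<phi> (split_tens \<one>\<^bsub>A\<^esub> m)" for m
  have st: "split_tens \<one>\<^bsub>A\<^esub> m \<in> carrier TN" if "m \<in> carrier M" for m
    using that by (simp add: TN_def N_iff split_tens_closed \<pi>_split)
  have d: "d \<in> module_hom A P M"
    using \<psi>D \<mu>_hom by (auto simp: module_hom_def d_def TN_def N_iff)
  have sec: "d (s m) = m" if "m \<in> carrier M" for m
    using that st by (simp add: d_def s_def \<psi>\<phi> \<mu>_split M.smult_one)
  have s: "s \<in> module_hom (A\<lparr>carrier := B\<rparr>) M P"
  proof -
    have inj: "inj_on \<psi> (carrier P)" using \<psi>_bij by (simp add: bij_betw_def)
    have "s (x \<oplus>\<^bsub>M\<^esub> y) = s x \<oplus>\<^bsub>P\<^esub> s y" if "x \<in> carrier M" "y \<in> carrier M" for x y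
    proof (rule inj_onD[OF inj])
      have "split_tens \<one>\<^bsub>A\<^esub> x \<oplus>\<^bsub>TN\<^esub> split_tens \<one>\<^bsub>A\<^esub> y = split_tens \<one>\<^bsub>A\<^esub> (x \<oplus>\<^bsub>M\<^esub> y)"
        using that by (simp add: split_tens_r_add TN_def)
      then show "\<psi> (s (x \<oplus>\<^bsub>M\<^esub> y)) = \<psi> (s x \<oplus>\<^bsub>P\<^esub> s y)"
        using that st by (simp add: s_def \<psi>\<phi> \<psi>D)
    qed (use that st in \<open>simp_all add: s_def \<psi>\<phi>\<close>)
    moreover have "s (b \<odot>\<^bsub>M\<^esub> x) = b \<odot>\<^bsub>P\<^esub> s x" if "b \<in> B" "x \<in> carrier M" for b x
    proof (rule inj_onD[OF inj])
      have bA: "b \<in> carrier A" using that(1) by (rule B_carrier)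
      \<comment> \<open>This is the \<open>B\<close>-linearity of the section: balancing moves
        \<open>b\<close> from \<open>m\<close> to the left of the tensor sign. Writing it there as
        \<open>b 1\<close> lets it be pulled out as a scalar, and \<open>A.r_one\<close> is disabled
        below to keep that form.\<close>
      have "split_tens \<one>\<^bsub>A\<^esub> (b \<odot>\<^bsub>M\<^esub> x) = split_tens (b \<otimes>\<^bsub>A\<^esub> \<one>\<^bsub>A\<^esub>) x"
        using that bA split_tens_balanced[of "\<one>\<^bsub>A\<^esub>" b x] by simp
      then have "b \<odot>\<^bsub>TN\<^esub> split_tens \<one>\<^bsub>A\<^esub> x = split_tens \<one>\<^bsub>A\<^esub> (b \<odot>\<^bsub>M\<^esub> x)"
        using that bA by (simp add: split_tens_smult TN_def del: A.r_one)
      then show "\<psi> (s (b \<odot>\<^bsub>M\<^esub> x)) = \<psi> (b \<odot>\<^bsub>P\<^esub> s x)"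
        using that bA st by (simp add: s_def \<psi>\<phi> \<psi>D M.smult_closed)
      show "s (b \<odot>\<^bsub>M\<^esub> x) \<in> carrier P" "b \<odot>\<^bsub>P\<^esub> s x \<in> carrier P"
        using that bA st by (simp_all add: s_def \<psi>\<phi> M.smult_closed P.smult_closed)
    qed
    ultimately show ?thesis
      using st \<psi>\<phi> by (auto simp: module_hom_def s_def)
  qed
  have supp: "e i \<odot>\<^bsub>P\<^esub> x = \<zero>\<^bsub>P\<^esub>"
    if i: "i \<in> J" and "\<And>j m. j \<in> J \<Longrightarrow> i < j \<Longrightarrow> m \<in> carrier M \<Longrightarrow> e j \<odot>\<^bsub>M\<^esub> m = \<zero>\<^bsub>M\<^esub>"
      and x: "x \<in> carrier P" "d x = \<zero>\<^bsub>M\<^esub>" for i x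
  proof -
    have "\<psi> x \<in> carrier TN" using \<psi>D(1) x by blast
    then have t: "\<psi> x \<in> carrier T" "\<pi> (\<psi> x) = \<psi> x" by (auto simp: TN_def N_iff)
    have ei: "e i \<in> carrier A" using i by (rule e_closed)
    have "e i \<odot>\<^bsub>T\<^esub> \<psi> x = tens (e i) \<zero>\<^bsub>M\<^esub>"
      using corner[OF i that(2) t(1)] t x(2) ei by (simp add: d_def M.smult_r_null)
    also have "\<dots> = \<zero>\<^bsub>T\<^esub>"
      using tens_finsum_r[of "e i" "\<lambda>_. \<zero>\<^bsub>M\<^esub>" "{}"] ei by simp
    finally have "\<psi> (e i \<odot>\<^bsub>P\<^esub> x) = \<zero>\<^bsub>TN\<^esub>"
      using \<psi>D(3)[OF ei x(1)] by (simp add: TN_def)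
    also have "\<dots> = \<psi> \<zero>\<^bsub>P\<^esub>"
      using module_hom_zero[OF P.M.abelian_group_axioms TN.M.abelian_group_axioms \<psi>_hom] by simp
    \<comment> \<open>The equation was obtained inside the tensor product; applying
      \<open>\<phi>\<close> takes it back to the copy.\<close>
    finally have "\<phi> (\<psi> (e i \<odot>\<^bsub>P\<^esub> x)) = \<phi> (\<psi> \<zero>\<^bsub>P\<^esub>)" by simp
    then show ?thesis using \<phi>\<psi> ei x(1) by (simp add: P.smult_closed)
  qed
  show ?thesis by (rule that[OF proj d s sec supp])
qed

end

section \<open>Splicing covers into a resolution\<close>

lemma rel_exact_zero:
  fixes M :: "('a, 'm) module"
  assumes "left_module A M" "carrier M = {\<zero>\<^bsub>M\<^esub>}" "subring B A"
  shows "rel_exact A B (\<lambda>_. M) (\<lambda>_ _. \<zero>\<^bsub>M\<^esub>)"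
proof -
  interpret M: left_module A M by fact
  have hom: "(\<lambda>_. \<zero>\<^bsub>M\<^esub>) \<in> module_hom R M M" if "carrier R \<subseteq> carrier A" for R :: "'a ring"
    using that by (auto simp: module_hom_def M.smult_r_null)
  have k: "a_kernel M M (\<lambda>_. \<zero>\<^bsub>M\<^esub>) = {\<zero>\<^bsub>M\<^esub>}" using assms by (auto simp: a_kernel_def')
  have "carrier (A\<lparr>carrier := B\<rparr>) \<subseteq> carrier A" using subringE(1)[OF assms(3)] by simp
  note homB = hom[OF this]
  \<comment> \<open>On the zero module the zero map is a section of itself.\<close>
  have "direct_summand (A\<lparr>carrier := B\<rparr>) M (a_kernel M M (\<lambda>_. \<zero>\<^bsub>M\<^esub>))"
    using left_module_restrict_ring[OF assms(1,3)] homB assms(2)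
    by (intro direct_summand_section(1)) auto
  then show ?thesis
    unfolding rel_exact_def using assms hom[of A] k by auto
qed

text \<open>The usual splice: a resolution of the kernel \<open>K\<close> of \<open>d\<close>
  becomes a resolution of \<open>M\<close> when \<open>K\<close> is replaced by \<open>P\<close> and
  \<open>M\<close> is put behind it. Since \<open>K\<close> is \<open>P\<close> with a smaller
  carrier, the first map of the old sequence can be kept as a function; only its codomain
  grows.\<close>

lemma rel_exact_prepend:
  fixes M P :: "('a, 'm) module"
  assumes M: "left_module A M" and P: "left_module A P" and B: "subring B A"
    and d: "d \<in> module_hom A P M" and s: "s \<in> module_hom (A\<lparr>carrier := B\<rparr>) M P"
    and ds: "\<And>m. m \<in> carrier M \<Longrightarrow> d (s m) = m"
    and X: "rel_exact A B X \<delta>" and X0: "X 0 = P\<lparr>carrier := a_kernel P M d\<rparr>"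
  defines "Y \<equiv> \<lambda>i. case i of 0 \<Rightarrow> M | Suc j \<Rightarrow> (case j of 0 \<Rightarrow> P | Suc l \<Rightarrow> X (Suc l))"
  defines "\<epsilon> \<equiv> \<lambda>i. case i of 0 \<Rightarrow> d | Suc j \<Rightarrow> \<delta> j"
  shows "rel_exact A B Y \<epsilon>"
proof -
  have X_mod: "left_module A (X i)" and X_hom: "\<delta> i \<in> module_hom A (X (Suc i)) (X i)"
    and X_onto: "\<delta> 0 ` carrier (X 1) = carrier (X 0)"
    and X_ex: "\<delta> (Suc i) ` carrier (X (Suc (Suc i))) = a_kernel (X (Suc i)) (X i) (\<delta> i)"
    and X_sum: "direct_summand (A\<lparr>carrier := B\<rparr>) (X (Suc i)) (a_kernel (X (Suc i)) (X i) (\<delta> i))" for i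
    using X unfolding rel_exact_def by blast+
  have d_cl: "x \<in> carrier P \<Longrightarrow> d x \<in> carrier M" and s_cl: "m \<in> carrier M \<Longrightarrow> s m \<in> carrier P" for x m
    using module_homD(1)[OF d] module_homD(1)[OF s] by auto
  have dB: "d \<in> module_hom (A\<lparr>carrier := B\<rparr>) P M"
    using d subringE(1)[OF B] by (auto simp: module_hom_def)
  \<comment> \<open>The only new splitting condition is the one at \<open>P\<close>, and the section
    \<open>s\<close> over \<open>B\<close> provides it.\<close>
  have P_sum: "direct_summand (A\<lparr>carrier := B\<rparr>) P (a_kernel P M d)"
    using left_module_restrict_ring[OF _ B] M P dB s ds by (intro direct_summand_section(1)) auto
  have onto: "d ` carrier P = carrier M"
    using d_cl s_cl ds by (auto simp: image_iff) (metis)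
  have \<delta>0: "\<delta> 0 \<in> module_hom A (X (Suc 0)) P"
    using X_hom[of 0] by (auto simp: X0 module_hom_def a_kernel_def')
  have ker0: "a_kernel (X (Suc 0)) (X 0) (\<delta> 0) = a_kernel (X (Suc 0)) P (\<delta> 0)"
    by (simp add: X0 a_kernel_def')
  have "left_module A (Y i)" for i
    using M P X_mod by (simp add: Y_def split: nat.split)
  moreover have "\<epsilon> i \<in> module_hom A (Y (Suc i)) (Y i)" for i
    using d \<delta>0 X_hom by (simp add: Y_def \<epsilon>_def split: nat.split)
  moreover have "\<epsilon> 0 ` carrier (Y 1) = carrier (Y 0)"
    using onto by (simp add: Y_def \<epsilon>_def)
  moreover have "\<epsilon> (Suc i) ` carrier (Y (Suc (Suc i))) = a_kernel (Y (Suc i)) (Y i) (\<epsilon> i)" for i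
    using X_onto X_ex[of 0] X_ex ker0 by (auto simp: Y_def \<epsilon>_def X0 split: nat.split)
  moreover have "direct_summand (A\<lparr>carrier := B\<rparr>) (Y (Suc i)) (a_kernel (Y (Suc i)) (Y i) (\<epsilon> i))" for i
    using P_sum X_sum[of 0] X_sum ker0 by (auto simp: Y_def \<epsilon>_def split: nat.split)
  ultimately show ?thesis unfolding rel_exact_def by blast
qed

text \<open>Induction on \<open>k\<close>, an upper bound for the vertices at which \<open>M\<close>
  is nonzero. Each cover leaves a kernel with bound lowered by one, so exactly the terms with index
  below \<open>k\<close> are needed.\<close>

lemma (in triangular_extension) resolution_of_supported:
  fixes M :: "('a, 'm) module" and \<iota> :: "'a \<Rightarrow> 'm"
  assumes inf: "infinite (UNIV :: 'm set)" "inj_on \<iota> (carrier A)"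
    and J: "J \<subseteq> {1..}"
    and "left_module A M"
    and "\<And>j m. j \<in> J \<Longrightarrow> k < j \<Longrightarrow> m \<in> carrier M \<Longrightarrow> e j \<odot>\<^bsub>M\<^esub> m = \<zero>\<^bsub>M\<^esub>"
  shows "\<exists>X d. rel_exact A B X d \<and> X 0 = M \<and> (\<forall>i<k. rel_projective A B (X (Suc i))) \<and>
    (\<forall>i\<ge>k. carrier (X (Suc i)) = {\<zero>\<^bsub>X (Suc i)\<^esub>})"
  using assms(4,5)
proof (induction k arbitrary: M)
  case 0
  interpret M: left_module A M by fact
  interpret triangular_extension_module A B J e M by unfold_locales
  \<comment> \<open>Indices start at \<open>1\<close>, so with bound \<open>0\<close> every
    \<open>e j\<close> kills \<open>M\<close>, and \<open>m\<close> is the sum of its components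
    \<open>e\<^sub>j m\<close>.\<close>
  have "m = \<zero>\<^bsub>M\<^esub>" if "m \<in> carrier M" for m
  proof -
    have "m = (\<Oplus>\<^bsub>M\<^esub>i\<in>J. e i \<odot>\<^bsub>M\<^esub> m)" using that by (simp add: e_smult_sum)
    also have "\<dots> = (\<Oplus>\<^bsub>M\<^esub>i\<in>J. \<zero>\<^bsub>M\<^esub>)"
    proof (rule M.M.finsum_cong')
      fix i assume "i \<in> J"
      then show "e i \<odot>\<^bsub>M\<^esub> m = \<zero>\<^bsub>M\<^esub>" using 0(2)[of i m] J that by force
    qed auto
    finally show ?thesis by simp
  qed
  then have "carrier M = {\<zero>\<^bsub>M\<^esub>}" by auto
  then show ?case
    using rel_exact_zero[OF 0(1) _ B_subring]
    by (intro exI[of _ "\<lambda>_. M"] exI[of _ "\<lambda>_ _. \<zero>\<^bsub>M\<^esub>"]) simp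
next
  case (Suc k)
  interpret M: left_module A M by fact
  interpret triangular_extension_module A B J e M by unfold_locales
  obtain P :: "('a, 'm) module" and d s where P: "rel_projective A B P"
    and d: "d \<in> module_hom A P M" and s: "s \<in> module_hom (A\<lparr>carrier := B\<rparr>) M P"
    and ds: "\<And>m. m \<in> carrier M \<Longrightarrow> d (s m) = m"
    and supp: "\<And>i x. \<lbrakk>i \<in> J; \<And>j m. j \<in> J \<Longrightarrow> i < j \<Longrightarrow> m \<in> carrier M \<Longrightarrow> e j \<odot>\<^bsub>M\<^esub> m = \<zero>\<^bsub>M\<^esub>;
        x \<in> carrier P; d x = \<zero>\<^bsub>M\<^esub>\<rbrakk> \<Longrightarrow> e i \<odot>\<^bsub>P\<^esub> x = \<zero>\<^bsub>P\<^esub>"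
    using relative_cover[OF inf] by blast
  have P_mod: "left_module A P" using P by (simp add: rel_projective_def)
  define K where "K = P\<lparr>carrier := a_kernel P M d\<rparr>"
  have K: "left_module A K"
    unfolding K_def by (intro left_module_submodule submodule_kernel P_mod Suc.prems(1) d)
  \<comment> \<open>The bound drops from \<open>Suc k\<close> to \<open>k\<close>: for
    \<open>i > k\<close> every \<open>j > i\<close> exceeds \<open>Suc k\<close>, so the support of
    \<open>M\<close> meets the condition in \<open>supp\<close>. This treats the top vertex and the
    empty ones above it alike.\<close>
  have "e i \<odot>\<^bsub>K\<^esub> x = \<zero>\<^bsub>K\<^esub>" if "i \<in> J" "k < i" "x \<in> carrier K" for i x
  proof -
    have "e j \<odot>\<^bsub>M\<^esub> m = \<zero>\<^bsub>M\<^esub>" if "j \<in> J" "i < j" "m \<in> carrier M" for j m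
      using that \<open>k < i\<close> by (intro Suc.prems(2)) auto
    then show ?thesis using that supp[of i x] by (simp add: K_def a_kernel_def')
  qed
  from Suc.IH[OF K this] obtain X \<delta> where X: "rel_exact A B X \<delta>" "X 0 = K"
    "\<And>i. i < k \<Longrightarrow> rel_projective A B (X (Suc i))"
    "\<And>i. i \<ge> k \<Longrightarrow> carrier (X (Suc i)) = {\<zero>\<^bsub>X (Suc i)\<^esub>}"
    by blast
  define Y where "Y i = (case i of 0 \<Rightarrow> M | Suc j \<Rightarrow> (case j of 0 \<Rightarrow> P | Suc l \<Rightarrow> X (Suc l)))" for i
  define \<epsilon> where "\<epsilon> i = (case i of 0 \<Rightarrow> d | Suc j \<Rightarrow> \<delta> j)" for i
  have "rel_exact A B Y \<epsilon>"
    using rel_exact_prepend[OF Suc.prems(1) P_mod B_subring d s ds X(1) X(2)[unfolded K_def]]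
    unfolding Y_def[abs_def] \<epsilon>_def[abs_def] .
  moreover have "Y 0 = M" by (simp add: Y_def)
  moreover have "rel_projective A B (Y (Suc i))" if "i < Suc k" for i
    using that P X(3) by (auto simp: Y_def split: nat.split)
  moreover have "carrier (Y (Suc i)) = {\<zero>\<^bsub>Y (Suc i)\<^esub>}" if "i \<ge> Suc k" for i
    using that X(4) by (auto simp: Y_def split: nat.split)
  ultimately show ?case by blast
qed

text \<open>Every module is supported on \<open>1, \<dots>, n\<close>, so the support condition
  holds vacuously for \<open>k = n\<close>.\<close>

theorem (in triangular_extension) rel_gldim_le:
  fixes \<iota> :: "'a \<Rightarrow> 'm"
  assumes "infinite (UNIV :: 'm set)" "inj_on \<iota> (carrier A)"
    and J: "J = {1..n}" and n: "n \<ge> 1"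
  shows "rel_gldim TYPE('m) A B \<le> enat (n - 1)"
  unfolding rel_gldim_def
proof (rule SUP_least, clarify)
  fix M :: "('a, 'm) module" assume "left_module A M"
  then obtain X d where X: "rel_exact A B X d" "X 0 = M" "\<forall>i<n. rel_projective A B (X (Suc i))"
    "\<forall>i\<ge>n. carrier (X (Suc i)) = {\<zero>\<^bsub>X (Suc i)\<^esub>}"
    using resolution_of_supported[OF assms(1,2), of M n] J by auto
  \<comment> \<open>The \<open>n\<close> projective terms have indices \<open>0\<close> to
    \<open>n - 1\<close>; as \<open>n\<close> is positive, \<open>i \<le> n - 1\<close> and
    \<open>i < n\<close> agree for natural numbers.\<close>
  have "rel_resolution A B M (n - 1) X d"
    using X n by (auto simp: rel_resolution_def)
  then show "rel_pd A B M \<le> enat (n - 1)"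
    unfolding rel_pd_def by (intro INF_lower) blast
qed

text \<open>All conditions are ring equations and memberships in \<open>B\<close>, which
  \<open>\<gamma>\<close> carries over. Surjectivity enters where a condition concerns every element
  of \<open>A\<close>, as in \<open>triangular\<close> and \<open>diagonal\<close>.\<close>

lemma (in triangular_extension) image_automorphism:
  assumes hom: "\<gamma> \<in> ring_hom A A" and onto: "\<gamma> ` carrier A = carrier A"
    and sub: "subring (\<gamma> ` B) A"
  shows "triangular_extension A (\<gamma> ` B) J (\<lambda>i. \<gamma> (e i))"
proof -
  interpret \<gamma>: ring_hom_ring A A \<gamma> by (rule ring_hom_ringI2[OF A.ring_axioms A.ring_axioms hom])
  have B: "b \<in> B \<Longrightarrow> b \<in> carrier A" for b using subringE(1)[OF B_subring] by blast
  have sandwich: "\<gamma> (e i) \<otimes>\<^bsub>A\<^esub> \<gamma> a \<otimes>\<^bsub>A\<^esub> \<gamma> (e j) = \<gamma> (e i \<otimes>\<^bsub>A\<^esub> a \<otimes>\<^bsub>A\<^esub> e j)"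
    if "i \<in> J" "j \<in> J" "a \<in> carrier A" for i j a
    using that e_closed by simp
  have pre: "\<exists>a'\<in>carrier A. a = \<gamma> a'" if "a \<in> carrier A" for a using onto that by blast
  show ?thesis
  proof (intro triangular_extension.intro triangular_extension_axioms.intro, goal_cases)
    case 1 show ?case by (rule A.ring_axioms)
  next
    case 2 show ?case by (rule sub)
  next
    case 3 show ?case by (rule finite_J)
  next
    case (4 i) then show ?case using e_closed by simp
  next
    case (5 i) then show ?case using e_closed e_idem \<gamma>.hom_mult[of "e i" "e i"] by simp
  next
    case (6 i j) then show ?case using e_closed e_orth \<gamma>.hom_mult[of "e i" "e j"] by simp
  next
    case 7
    have "\<gamma> (\<Oplus>\<^bsub>A\<^esub>i\<in>J. e i) = (\<Oplus>\<^bsub>A\<^esub>i\<in>J. \<gamma> (e i))"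
      using e_closed by (intro hom_finsum[OF A.abelian_group_axioms A.abelian_group_axioms]) (auto simp: hom_def)
    then show ?case using e_sum by simp
  next
    case (8 i j a)
    then obtain a' where "a' \<in> carrier A" "a = \<gamma> a'" using pre by blast
    then show ?case using 8 triangular[of i j a'] by (simp add: sandwich del: \<gamma>.hom_mult)
  next
    case (9 i j b)
    then obtain b' where "b' \<in> B" "b = \<gamma> b'" by blast
    then show ?case using 9 off_diagonal[of i j b'] by (simp add: sandwich B del: \<gamma>.hom_mult)
  next
    case (10 i a)
    then obtain a' where a': "a' \<in> carrier A" "a = \<gamma> a'" using pre by blast
    obtain c r where c: "c \<in> B" "r \<in> B" "c \<otimes>\<^bsub>A\<^esub> e i = e i \<otimes>\<^bsub>A\<^esub> c"
      "e i \<otimes>\<^bsub>A\<^esub> a' \<otimes>\<^bsub>A\<^esub> e i = c \<otimes>\<^bsub>A\<^esub> e i \<oplus>\<^bsub>A\<^esub> r"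
      using diagonal[OF 10(1) a'(1)] by blast
    have "\<gamma> c \<otimes>\<^bsub>A\<^esub> \<gamma> (e i) = \<gamma> (e i) \<otimes>\<^bsub>A\<^esub> \<gamma> c"
      using c B e_closed[OF 10(1)] by (metis \<gamma>.hom_mult)
    moreover have "\<gamma> (e i) \<otimes>\<^bsub>A\<^esub> a \<otimes>\<^bsub>A\<^esub> \<gamma> (e i) = \<gamma> c \<otimes>\<^bsub>A\<^esub> \<gamma> (e i) \<oplus>\<^bsub>A\<^esub> \<gamma> r"
      unfolding a'(2) sandwich[OF 10(1) 10(1) a'(1)] c(4) using c(1,2) B e_closed[OF 10(1)] by simp
    ultimately show ?case using c(1,2) by blast
  qed
qed

text \<open>The direction is the one that undoes \<open>b \<mapsto> z b z\<inverse>\<close>, the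
  form in which \<open>conjugate_in\<close> passes from \<open>B\<close> to
  \<open>C\<close>.\<close>

lemma (in ring) conjugation_automorphism:
  assumes z: "z \<in> Units R"
  shows "(\<lambda>x. inv z \<otimes> x \<otimes> z) \<in> ring_hom R R"
    and "(\<lambda>x. inv z \<otimes> x \<otimes> z) ` carrier R = carrier R"
    and "x \<in> carrier R \<Longrightarrow> inv z \<otimes> (z \<otimes> x \<otimes> inv z) \<otimes> z = x"
proof -
  have zc: "z \<in> carrier R" "inv z \<in> carrier R" using z by auto
  have zi: "z \<otimes> inv z = \<one>" "inv z \<otimes> z = \<one>" using z by auto
  have cancel: "z \<otimes> (inv z \<otimes> x) = x" "inv z \<otimes> (z \<otimes> x) = x" if "x \<in> carrier R" for x
    using that zc zi by (simp_all add: m_assoc[symmetric])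
  show cancel_conj: "inv z \<otimes> (z \<otimes> x \<otimes> inv z) \<otimes> z = x" if "x \<in> carrier R" for x
    using that zc zi by (simp add: m_assoc cancel)
  show "(\<lambda>x. inv z \<otimes> x \<otimes> z) \<in> ring_hom R R"
    using zc zi by (intro ring_hom_memI) (auto simp: m_assoc cancel r_distr l_distr)
  show "(\<lambda>x. inv z \<otimes> x \<otimes> z) ` carrier R = carrier R"
  proof (intro equalityI subsetI)
    fix x assume x: "x \<in> carrier R"
    then show "x \<in> (\<lambda>x. inv z \<otimes> x \<otimes> z) ` carrier R"
      using cancel_conj[OF x] zc by (intro image_eqI[of _ _ "z \<otimes> x \<otimes> inv z"]) auto
  qed (use zc in auto)
qed

section \<open>Generated subalgebras\<close>

lemma unital_subalgebra_iff:
  assumes "ring A"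
  shows "unital_subalgebra K B A \<longleftrightarrow> subring B A \<and> (\<forall>k\<in>K. \<forall>b\<in>B. k \<otimes>\<^bsub>A\<^esub> b \<in> B)"
  unfolding unital_subalgebra_def subalgebra_def subalgebra_axioms_def
  by (auto dest: subring.axioms(1))

lemma generated_subalgebra_props:
  assumes "ring A" "K \<subseteq> carrier A" "X \<subseteq> carrier A"
  shows "unital_subalgebra K (generated_subalgebra K A X) A" "X \<subseteq> generated_subalgebra K A X"
proof -
  interpret A: ring A by fact
  let ?\<B> = "{B. unital_subalgebra K B A \<and> X \<subseteq> B}"
  have "unital_subalgebra K (carrier A) A"
    using assms(2) A.carrier_is_subring by (auto simp: unital_subalgebra_iff[OF assms(1)])
  \<comment> \<open>The family being intersected is nonempty, so the intersection lies inside
    \<open>A\<close>.\<close>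
  then have carr: "carrier A \<in> ?\<B>" using assms(3) by simp
  show "X \<subseteq> generated_subalgebra K A X" by (auto simp: generated_subalgebra_def)
  have sub: "subring S A" and sm: "k \<in> K \<Longrightarrow> b \<in> S \<Longrightarrow> k \<otimes>\<^bsub>A\<^esub> b \<in> S" if "S \<in> ?\<B>" for S k b
    using that by (auto simp: unital_subalgebra_iff[OF assms(1)])
  have "subring (\<Inter>?\<B>) A"
  proof (rule A.subringI)
    show "\<Inter>?\<B> \<subseteq> carrier A" using carr by blast
    show "\<one>\<^bsub>A\<^esub> \<in> \<Inter>?\<B>" by (intro InterI) (rule subringE(3)[OF sub])
    show "\<ominus>\<^bsub>A\<^esub> h \<in> \<Inter>?\<B>" if "h \<in> \<Inter>?\<B>" for h
      using that by (intro InterI subringE(5)[OF sub]) (blast+)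
    show "g \<otimes>\<^bsub>A\<^esub> h \<in> \<Inter>?\<B>" "g \<oplus>\<^bsub>A\<^esub> h \<in> \<Inter>?\<B>" if "g \<in> \<Inter>?\<B>" "h \<in> \<Inter>?\<B>" for g h
      using that by (auto intro!: subringE(6,7)[OF sub])
  qed
  moreover have "k \<otimes>\<^bsub>A\<^esub> b \<in> \<Inter>?\<B>" if "k \<in> K" "b \<in> \<Inter>?\<B>" for k b
    using that by (auto intro!: sm)
  ultimately show "unital_subalgebra K (generated_subalgebra K A X) A"
    by (auto simp: unital_subalgebra_iff[OF assms(1)] generated_subalgebra_def)
qed

lemma generated_subalgebra_minimal:
  "unital_subalgebra K B A \<Longrightarrow> X \<subseteq> B \<Longrightarrow> generated_subalgebra K A X \<subseteq> B"
  unfolding generated_subalgebra_def by blast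

lemma (in ring) subring_finsum:
  assumes "subring C R" "\<And>i. i \<in> S \<Longrightarrow> f i \<in> C"
  shows "(\<Oplus>i\<in>S. f i) \<in> C"
proof -
  note C = subringE[OF assms(1)]
  show ?thesis
    using assms(2)
  proof (induction S rule: infinite_finite_induct)
    case (insert x F)
    then have "f ` insert x F \<subseteq> carrier R" using C(1) by blast
    then have "(\<Oplus>i\<in>insert x F. f i) = f x \<oplus> (\<Oplus>i\<in>F. f i)" using insert by (intro finsum_insert) auto
    then show ?case using insert C(7) by simp
  qed (use C(2) in simp_all)
qed

text \<open>
  The elements whose off-diagonal corners lie in \<open>C\<close> form a subalgebra, because \<open>C\<close> absorbs
  multiplication by the diagonal corners.
\<close>

lemma generated_subalgebra_off_diagonal:
  fixes R :: "'a ring" (structure)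
  assumes "ring R"
    and K: "K \<subseteq> carrier R" "\<And>k a. k \<in> K \<Longrightarrow> a \<in> carrier R \<Longrightarrow> k \<otimes> a = a \<otimes> k"
    and X: "X \<subseteq> carrier R"
    and J: "finite J" "\<And>i. i \<in> J \<Longrightarrow> e i \<in> carrier R" "\<And>i. i \<in> J \<Longrightarrow> e i \<otimes> e i = e i"
      "\<And>i j. i \<in> J \<Longrightarrow> j \<in> J \<Longrightarrow> i \<noteq> j \<Longrightarrow> e i \<otimes> e j = \<zero>" "(\<Oplus>i\<in>J. e i) = \<one>"
  defines "C \<equiv> generated_subalgebra K R X"
  assumes diag: "\<And>i a. i \<in> J \<Longrightarrow> a \<in> carrier R \<Longrightarrow> \<exists>c\<in>K. \<exists>r\<in>C. e i \<otimes> a \<otimes> e i = c \<otimes> e i \<oplus> r"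
    and off: "\<And>x i j. x \<in> X \<Longrightarrow> i \<in> J \<Longrightarrow> j \<in> J \<Longrightarrow> i \<noteq> j \<Longrightarrow> e i \<otimes> x \<otimes> e j \<in> C"
    and b: "b \<in> C" and ij: "i \<in> J" "j \<in> J" "i \<noteq> j"
  shows "e i \<otimes> b \<otimes> e j \<in> C"
proof -
  interpret ring R by fact
  have "unital_subalgebra K C R" and "X \<subseteq> C"
    unfolding C_def using generated_subalgebra_props[OF ring_axioms K(1) X] by auto
  then have C_sub: "subring C R" and C_smult: "\<And>k b. k \<in> K \<Longrightarrow> b \<in> C \<Longrightarrow> k \<otimes> b \<in> C"
    by (auto simp: unital_subalgebra_iff[OF ring_axioms])
  note CE = subringE[OF C_sub]
  have CC: "c \<in> C \<Longrightarrow> c \<in> carrier R" for c using CE(1) by blast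
  define D where "D = {b \<in> carrier R. \<forall>i\<in>J. \<forall>j\<in>J. i \<noteq> j \<longrightarrow> e i \<otimes> b \<otimes> e j \<in> C}"
  have KC: "k \<in> carrier R" if "k \<in> K" for k using that K(1) by blast
  have "subring D R"
  proof (rule subringI)
    show "D \<subseteq> carrier R" by (auto simp: D_def)
    show "\<one> \<in> D" using J(2,4) CE(2) by (auto simp: D_def)
    show "\<ominus> h \<in> D" if "h \<in> D" for h
      using that J(2) CE(5) by (auto simp: D_def l_minus r_minus)
    show "h1 \<oplus> h2 \<in> D" if "h1 \<in> D" "h2 \<in> D" for h1 h2
      using that J(2) CE(7) by (auto simp: D_def r_distr l_distr)
    show "h1 \<otimes> h2 \<in> D" if h: "h1 \<in> D" "h2 \<in> D" for h1 h2
    proof -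
      have hR: "h1 \<in> carrier R" "h2 \<in> carrier R" using h by (auto simp: D_def)
      have "e i \<otimes> (h1 \<otimes> h2) \<otimes> e j \<in> C" if ij: "i \<in> J" "j \<in> J" "i \<noteq> j" for i j
      proof -
        have ei: "e i \<in> carrier R" and ej: "e j \<in> carrier R" using ij J by auto
        have "(e i \<otimes> h1 \<otimes> e k) \<otimes> (e k \<otimes> h2 \<otimes> e j) \<in> C" if k: "k \<in> J" for k
        proof -
          have ek: "e k \<in> carrier R" using k J by auto
          define x y where "x = e i \<otimes> h1 \<otimes> e k" and "y = e k \<otimes> h2 \<otimes> e j"
          have xy: "x \<in> carrier R" "y \<in> carrier R" using ei ej ek hR by (auto simp: x_def y_def)
          have xk: "x \<otimes> e k = x" and ky: "e k \<otimes> y = y"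
            using ei ej ek hR J(3)[OF k] by (simp_all add: x_def y_def m_assoc) (simp add: m_assoc[symmetric])
          \<comment> \<open>As \<open>i \<noteq> j\<close>, at least one of the two factors is off
            the diagonal and hence in \<open>C\<close>. A diagonal factor multiplies it by a scalar
            and by an element of \<open>C\<close>.\<close>
          consider "k = i" | "k = j" | "k \<noteq> i" "k \<noteq> j" by blast
          then have "x \<otimes> y \<in> C"
          proof cases
            case 1
            obtain c r where c: "c \<in> K" "r \<in> C" "x = c \<otimes> e k \<oplus> r"
              using diag[OF ij(1) hR(1)] 1 by (auto simp: x_def)
            have y: "y \<in> C" using h(2) ij 1 by (simp add: D_def y_def)
            have "x \<otimes> y = c \<otimes> y \<oplus> r \<otimes> y"
              using c KC CC xy ek ky by (simp add: l_distr m_assoc)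
            then show ?thesis using c y CE(6,7) C_smult by simp
          next
            case 2
            obtain c r where c: "c \<in> K" "r \<in> C" "y = c \<otimes> e k \<oplus> r"
              using diag[OF ij(2) hR(2)] 2 by (auto simp: y_def)
            have x: "x \<in> C" using h(1) ij 2 by (simp add: D_def x_def)
            \<comment> \<open>Here the diagonal factor stands on the right, and centrality brings
              its scalar to the front, where closure of \<open>C\<close> under scalars
              applies.\<close>
            have "x \<otimes> (c \<otimes> e k) = c \<otimes> (x \<otimes> e k)"
              using K(2)[OF c(1)] KC[OF c(1)] xy ek by (metis m_assoc)
            then have "x \<otimes> y = c \<otimes> x \<oplus> x \<otimes> r"
              using c KC CC xy ek xk by (simp add: r_distr)
            then show ?thesis using c x CE(6,7) C_smult by simp
          next
            case 3
            then have "x \<in> C" "y \<in> C" using h ij k by (auto simp: D_def x_def y_def)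
            then show ?thesis by (rule CE(6))
          qed
          then show ?thesis by (simp add: x_def y_def)
        qed
        then have "(\<Oplus>k\<in>J. (e i \<otimes> h1 \<otimes> e k) \<otimes> (e k \<otimes> h2 \<otimes> e j)) \<in> C"
          by (rule subring_finsum[OF C_sub])
        \<comment> \<open>The sum is \<open>e\<^sub>i h\<^sub>1 h\<^sub>2 e\<^sub>j\<close> with
          \<open>1\<close> inserted in the middle as the sum of the \<open>e\<^sub>k\<close>; each
          \<open>e\<^sub>k\<close> was doubled to give both factors a corner.\<close>
        also have "(\<Oplus>k\<in>J. (e i \<otimes> h1 \<otimes> e k) \<otimes> (e k \<otimes> h2 \<otimes> e j)) = (\<Oplus>k\<in>J. (e i \<otimes> h1) \<otimes> e k \<otimes> (h2 \<otimes> e j))"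
        proof (rule finsum_cong')
          fix k assume k: "k \<in> J"
          have "e k \<otimes> (e k \<otimes> (h2 \<otimes> e j)) = e k \<otimes> (h2 \<otimes> e j)"
            using k J ej hR by (simp add: m_assoc[symmetric])
          then show "(e i \<otimes> h1 \<otimes> e k) \<otimes> (e k \<otimes> h2 \<otimes> e j) = (e i \<otimes> h1) \<otimes> e k \<otimes> (h2 \<otimes> e j)"
            using k J ei ej hR by (simp add: m_assoc)
        qed (use J ei ej hR in auto)
        also have "\<dots> = (\<Oplus>k\<in>J. (e i \<otimes> h1) \<otimes> e k) \<otimes> (h2 \<otimes> e j)"
          using J ei ej hR by (intro finsum_ldistr[symmetric]) auto
        also have "(\<Oplus>k\<in>J. (e i \<otimes> h1) \<otimes> e k) = e i \<otimes> h1"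
          using J(1,2,5) ei hR finsum_rdistr[of J "e i \<otimes> h1" e] by (simp add: Pi_iff)
        finally show ?thesis using ei ej hR by (simp add: m_assoc)
      qed
      then show ?thesis using hR by (simp add: D_def)
    qed
  qed
  moreover have "k \<otimes> d \<in> D" if k: "k \<in> K" and d: "d \<in> D" for k d
  proof -
    have "e i \<otimes> (k \<otimes> d) \<otimes> e j = k \<otimes> (e i \<otimes> d \<otimes> e j)" if "i \<in> J" "j \<in> J" for i j
      using that d k J(2) KC[OF k] K(2)[OF k, of "e i"] by (simp add: D_def m_assoc[symmetric])
    then show ?thesis using k d KC[OF k] C_smult by (auto simp: D_def)
  qed
  ultimately have "unital_subalgebra K D R" by (simp add: unital_subalgebra_iff[OF ring_axioms])
  moreover have "X \<subseteq> D" using X off by (auto simp: D_def)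
  ultimately have "C \<subseteq> D" unfolding C_def by (rule generated_subalgebra_minimal)
  then show ?thesis using b ij by (auto simp: D_def)
qed

section \<open>Path algebras\<close>

lemma sum_single_lookup:
  "(\<Sum>p\<in>Poly_Mapping.keys f. Poly_Mapping.single p (Poly_Mapping.lookup f p)) = f"
  by (rule poly_mapping_eqI)
    (auto simp: lookup_sum lookup_single when_def sum.delta' in_keys_iff)

text \<open>Induction over linear combinations. The set \<open>S\<close> confines the supports, so
  that in the case \<open>single\<close> the basis element is known to be a path of the
  quiver.\<close>

lemma poly_mapping_single_induct [consumes 1, case_names zero single add]:
  fixes f :: "'p \<Rightarrow>\<^sub>0 'c::comm_monoid_add"
  assumes "Poly_Mapping.keys f \<subseteq> S"
    and "P 0"
    and "\<And>p c. p \<in> S \<Longrightarrow> P (Poly_Mapping.single p c)"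
    and "\<And>f g. Poly_Mapping.keys f \<subseteq> S \<Longrightarrow> Poly_Mapping.keys g \<subseteq> S \<Longrightarrow> P f \<Longrightarrow> P g \<Longrightarrow> P (f + g)"
  shows "P f"
proof -
  let ?s = "\<lambda>p. Poly_Mapping.single p (Poly_Mapping.lookup f p)"
  have "P (sum ?s K) \<and> Poly_Mapping.keys (sum ?s K) \<subseteq> S" if "finite K" "K \<subseteq> S" for K
    using that
  proof (induction K rule: finite_induct)
    case empty
    then show ?case using assms(2) by simp
  next
    case (insert p K)
    have "Poly_Mapping.keys (?s p) \<subseteq> S" using insert.prems by simp
    then show ?case
      using insert assms(3)[of p] assms(4)[of "?s p" "sum ?s K"] keys_add[of "?s p" "sum ?s K"]
      by auto
  qed
  from this[of "Poly_Mapping.keys f"] show ?thesis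
    using assms(1) sum_single_lookup[of f] by simp
qed

text \<open>The product of two basis paths with coefficient \<open>c\<close>, zero if the ends do
  not match; \<open>q\<close> is traversed first. Keeping the coefficient as an argument makes
  additivity in \<open>c\<close> visible, from which biadditivity of \<open>path_mult\<close>
  follows.\<close>

definition path_comp :: "('v, 'e) qpath \<Rightarrow> ('v, 'e) qpath \<Rightarrow> 'k::comm_ring_1 \<Rightarrow> (('v, 'e) qpath \<Rightarrow>\<^sub>0 'k)" where
  "path_comp p q c = (if snd (snd q) = fst p
     then Poly_Mapping.single (fst q, fst (snd q) @ fst (snd p), snd (snd p)) c else 0)"

lemma path_comp_add: "path_comp p q (c + d) = path_comp p q c + path_comp p q d"
  by (simp add: path_comp_def single_add)

lemma path_comp_zero [simp]: "path_comp p q 0 = 0"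
  by (simp add: path_comp_def)

text \<open>Zero coefficients contribute nothing, so the sums may run over larger sets. This allows
  \<open>f\<close>, \<open>f'\<close> and \<open>f + f'\<close>, whose supports differ, to be
  compared over one index set.\<close>

lemma path_mult_superset:
  assumes "finite S" "finite T" "Poly_Mapping.keys f \<subseteq> S" "Poly_Mapping.keys g \<subseteq> T"
  shows "path_mult f g = (\<Sum>p\<in>S. \<Sum>q\<in>T. path_comp p q (Poly_Mapping.lookup f p * Poly_Mapping.lookup g q))"
proof -
  have "path_mult f g = (\<Sum>p\<in>Poly_Mapping.keys f. \<Sum>q\<in>Poly_Mapping.keys g.
      path_comp p q (Poly_Mapping.lookup f p * Poly_Mapping.lookup g q))"
    unfolding path_mult_def by (intro sum.cong refl) (auto simp: path_comp_def case_prod_beta intro!: sum.cong)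
  also have "\<dots> = (\<Sum>p\<in>Poly_Mapping.keys f. \<Sum>q\<in>T.
      path_comp p q (Poly_Mapping.lookup f p * Poly_Mapping.lookup g q))"
    by (intro sum.cong refl sum.mono_neutral_left assms) (auto simp: in_keys_iff)
  also have "\<dots> = (\<Sum>p\<in>S. \<Sum>q\<in>T. path_comp p q (Poly_Mapping.lookup f p * Poly_Mapping.lookup g q))"
    by (intro sum.mono_neutral_left assms) (auto simp: in_keys_iff)
  finally show ?thesis .
qed

lemma path_mult_add_left: "path_mult (f + f') g = path_mult f g + path_mult f' g"
proof -
  let ?S = "Poly_Mapping.keys f \<union> Poly_Mapping.keys f'"
  have "path_mult h g = (\<Sum>p\<in>?S. \<Sum>q\<in>Poly_Mapping.keys g.
      path_comp p q (Poly_Mapping.lookup h p * Poly_Mapping.lookup g q))"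
    if "Poly_Mapping.keys h \<subseteq> ?S" for h
    using that by (intro path_mult_superset) auto
  from this[of f] this[of f'] this[of "f + f'"] show ?thesis
    using keys_add[of f f'] by (simp add: lookup_add distrib_right path_comp_add sum.distrib)
qed

lemma path_mult_add_right: "path_mult f (g + g') = path_mult f g + path_mult f g'"
proof -
  let ?S = "Poly_Mapping.keys g \<union> Poly_Mapping.keys g'"
  have "path_mult f h = (\<Sum>p\<in>Poly_Mapping.keys f. \<Sum>q\<in>?S.
      path_comp p q (Poly_Mapping.lookup f p * Poly_Mapping.lookup h q))"
    if "Poly_Mapping.keys h \<subseteq> ?S" for h
    using that by (intro path_mult_superset) auto
  from this[of g] this[of g'] this[of "g + g'"] show ?thesis
    using keys_add[of g g'] by (simp add: lookup_add distrib_left path_comp_add sum.distrib)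
qed

lemma path_mult_zero [simp]: "path_mult 0 g = 0" "path_mult f 0 = 0"
  by (simp_all add: path_mult_def)

lemma path_mult_single:
  "path_mult (Poly_Mapping.single p c) (Poly_Mapping.single q d) = path_comp p q (c * d)"
  using path_mult_superset[of "{p}" "{q}" "Poly_Mapping.single p c" "Poly_Mapping.single q d"]
  by simp

lemma path_mult_sum_left: "path_mult (sum f S) g = (\<Sum>i\<in>S. path_mult (f i) g)"
  by (induction S rule: infinite_finite_induct) (simp_all add: path_mult_add_left)

lemma path_mult_sum_right: "path_mult f (sum g S) = (\<Sum>i\<in>S. path_mult f (g i))"
  by (induction S rule: infinite_finite_induct) (simp_all add: path_mult_add_right)

text \<open>Both sides are additive in each argument, so the claim is reduced to basis paths one
  argument at a time; there it is associativity of concatenation.\<close>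

lemma path_mult_assoc: "path_mult (path_mult f g) h = path_mult f (path_mult g h)"
proof -
  have single: "path_mult (path_mult (Poly_Mapping.single p a) (Poly_Mapping.single q b)) (Poly_Mapping.single r c)
      = path_mult (Poly_Mapping.single p a) (path_mult (Poly_Mapping.single q b) (Poly_Mapping.single r c))"
    for p q r :: "('a, 'b) qpath" and a b c :: 'c
    by (auto simp: path_mult_single path_comp_def mult.assoc)
  have *: "path_mult (path_mult (Poly_Mapping.single p a) (Poly_Mapping.single q b)) h
      = path_mult (Poly_Mapping.single p a) (path_mult (Poly_Mapping.single q b) h)" for p q a b
    using subset_UNIV[of "Poly_Mapping.keys h"]
    by (induction h rule: poly_mapping_single_induct) (simp_all add: single path_mult_add_right)
  have **: "path_mult (path_mult (Poly_Mapping.single p a) g) h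
      = path_mult (Poly_Mapping.single p a) (path_mult g h)" for p a
    using subset_UNIV[of "Poly_Mapping.keys g"]
    by (induction g rule: poly_mapping_single_induct) (simp_all add: * path_mult_add_right path_mult_add_left)
  show ?thesis
    using subset_UNIV[of "Poly_Mapping.keys f"]
    by (induction f rule: poly_mapping_single_induct) (simp_all add: ** path_mult_add_left)
qed

section \<open>Closure under composition, scalars and the ring structure\<close>

lemma cas_append:
  "pre_digraph.cas Q u as v \<Longrightarrow> pre_digraph.cas Q v bs w \<Longrightarrow> pre_digraph.cas Q u (as @ bs) w"
  by (induction as arbitrary: u) (auto simp: pre_digraph.cas.simps)

lemma qpaths_comp:
  "(u, as, v) \<in> qpaths Q \<Longrightarrow> (v, bs, w) \<in> qpaths Q \<Longrightarrow> (u, as @ bs, w) \<in> qpaths Q"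
  by (auto simp: qpaths_def pre_digraph.awalk_def cas_append)

lemma keys_path_mult:
  assumes "Poly_Mapping.keys f \<subseteq> qpaths Q" "Poly_Mapping.keys g \<subseteq> qpaths Q"
  shows "Poly_Mapping.keys (path_mult f g) \<subseteq> qpaths Q"
proof -
  have comp: "Poly_Mapping.keys (path_comp p q c) \<subseteq> qpaths Q"
    if "p \<in> qpaths Q" "q \<in> qpaths Q" for p q and c :: 'c
    using that by (cases p; cases q) (auto simp: path_comp_def intro: qpaths_comp)
  have "Poly_Mapping.keys (path_mult (Poly_Mapping.single p a) g) \<subseteq> qpaths Q" if "p \<in> qpaths Q" for p a
    using assms(2)
    by (induction g rule: poly_mapping_single_induct)
      (simp_all add: path_mult_single path_mult_add_right order.trans[OF keys_add] comp that)
  note single = this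
  show ?thesis
    using assms(1)
    by (induction f rule: poly_mapping_single_induct)
      (simp_all add: path_mult_add_left order.trans[OF keys_add] single)
qed

text \<open>The scalar \<open>c\<close> as a multiple of the identity; the cosets of these elements
  form \<open>bq_scalars\<close>.\<close>

definition path_scalar :: "('v, 'e) pre_digraph \<Rightarrow> 'k \<Rightarrow> (('v, 'e) qpath \<Rightarrow>\<^sub>0 'k::comm_ring_1)" where
  "path_scalar Q c = (\<Sum>v\<in>verts Q. Poly_Mapping.single (v, [], v) c)"

lemma qpaths_ends:
  assumes "wf_digraph Q" "(u, as, v) \<in> qpaths Q"
  shows "u \<in> verts Q" "v \<in> verts Q"
proof -
  interpret wf_digraph Q by fact
  show "u \<in> verts Q" "v \<in> verts Q" using assms(2) by (auto simp: qpaths_def)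
qed

lemma path_scalar_mult_single:
  assumes "fin_digraph Q" "(u, as, v) \<in> qpaths Q"
  shows "path_mult (path_scalar Q c) (Poly_Mapping.single (u, as, v) d) = Poly_Mapping.single (u, as, v) (c * d)"
    and "path_mult (Poly_Mapping.single (u, as, v) d) (path_scalar Q c) = Poly_Mapping.single (u, as, v) (c * d)"
proof -
  interpret fin_digraph Q by fact
  note ends = qpaths_ends[OF wf_digraph_axioms assms(2)]
  have "path_mult (path_scalar Q c) (Poly_Mapping.single (u, as, v) d)
      = (\<Sum>w\<in>verts Q. if v = w then Poly_Mapping.single (u, as, v) (c * d) else 0)"
    by (auto simp: path_scalar_def path_mult_sum_left path_mult_single path_comp_def intro!: sum.cong)
  then show "path_mult (path_scalar Q c) (Poly_Mapping.single (u, as, v) d) = Poly_Mapping.single (u, as, v) (c * d)"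
    using ends by simp
  have "path_mult (Poly_Mapping.single (u, as, v) d) (path_scalar Q c)
      = (\<Sum>w\<in>verts Q. if u = w then Poly_Mapping.single (u, as, v) (c * d) else 0)"
    by (auto simp: path_scalar_def path_mult_sum_right path_mult_single path_comp_def mult.commute intro!: sum.cong)
  then show "path_mult (Poly_Mapping.single (u, as, v) d) (path_scalar Q c) = Poly_Mapping.single (u, as, v) (c * d)"
    using ends by simp
qed

lemma path_scalar_central:
  assumes "fin_digraph Q" "Poly_Mapping.keys f \<subseteq> qpaths Q"
  shows "path_mult (path_scalar Q c) f = path_mult f (path_scalar Q c)"
  using assms(2)
  by (induction f rule: poly_mapping_single_induct)
    (auto simp: path_mult_add_left path_mult_add_right path_scalar_mult_single[OF assms(1)])

lemma path_scalar_one: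
  assumes "fin_digraph Q" "Poly_Mapping.keys f \<subseteq> qpaths Q"
  shows "path_mult (path_scalar Q 1) f = f"
  using assms(2)
  by (induction f rule: poly_mapping_single_induct)
    (auto simp: path_mult_add_right path_scalar_mult_single[OF assms(1)])

lemma vertex_in_qpaths: "v \<in> verts Q \<Longrightarrow> (v, [], v) \<in> qpaths Q"
  by (simp add: qpaths_def pre_digraph.awalk_def pre_digraph.cas.simps)

lemma path_scalar_keys: "Poly_Mapping.keys (path_scalar Q c) \<subseteq> qpaths Q"
  unfolding path_scalar_def
  by (rule order.trans[OF keys_sum]) (auto intro: vertex_in_qpaths split: if_splits)

lemma path_scalar_add: "path_scalar Q (c + d) = path_scalar Q c + path_scalar Q d"
  by (simp add: path_scalar_def single_add sum.distrib)

lemma path_algebra_simps [simp]: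
  "carrier (path_algebra Q) = {f. Poly_Mapping.keys f \<subseteq> qpaths Q}"
  "f \<otimes>\<^bsub>path_algebra Q\<^esub> g = path_mult f g"
  "\<one>\<^bsub>path_algebra Q\<^esub> = path_scalar Q 1"
  "\<zero>\<^bsub>path_algebra Q\<^esub> = 0"
  "f \<oplus>\<^bsub>path_algebra Q\<^esub> g = f + g"
  by (simp_all add: path_algebra_def path_scalar_def)

lemma ring_path_algebra:
  assumes "fin_digraph Q"
  shows "ring (path_algebra Q :: (('v, 'e) qpath \<Rightarrow>\<^sub>0 'k::comm_ring_1) ring)"
proof (rule ringI)
  show "abelian_group (path_algebra Q :: (('v, 'e) qpath \<Rightarrow>\<^sub>0 'k) ring)"
  proof (rule abelian_groupI)
    fix x :: "('v, 'e) qpath \<Rightarrow>\<^sub>0 'k" assume "x \<in> carrier (path_algebra Q)"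
    then show "\<exists>y\<in>carrier (path_algebra Q). y \<oplus>\<^bsub>path_algebra Q\<^esub> x = \<zero>\<^bsub>path_algebra Q\<^esub>"
      by (intro bexI[of _ "- x"]) auto
  qed (auto simp: add_ac dest: subsetD[OF keys_add])
  show "Group.monoid (path_algebra Q :: (('v, 'e) qpath \<Rightarrow>\<^sub>0 'k) ring)"
    by (rule monoidI)
      (simp_all add: keys_path_mult path_scalar_keys path_mult_assoc path_scalar_one[OF assms]
        path_scalar_central[OF assms, symmetric])
qed (simp_all add: path_mult_add_left path_mult_add_right)

lemma path_algebra_finsum:
  assumes "f \<in> S \<rightarrow> carrier (path_algebra Q)" "fin_digraph Q"
  shows "finsum (path_algebra Q) f S = sum f S"
proof -
  interpret ring "path_algebra Q" by (rule ring_path_algebra[OF assms(2)])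
  show ?thesis
    using assms(1)
  proof (induction S rule: infinite_finite_induct)
    case (insert x F)
    then show ?case by (subst finsum_insert) auto
  qed simp_all
qed

text \<open>Composition is from right to left: the left idempotent tests the end \<open>v\<close> of
  the path and the right one its start \<open>u\<close>.\<close>

lemma path_vertex_sandwich:
  "path_mult (path_mult (path_vertex i) (Poly_Mapping.single (u, as, v) c)) (path_vertex j)
    = (if v = i \<and> u = j then Poly_Mapping.single (u, as, v) c else 0)"
  by (auto simp: path_vertex_def path_mult_single path_comp_def)

section \<open>Paths in a quiver whose arrows never ascend\<close>

lemma cas_descending:
  fixes Q :: "('v::linorder, 'e) pre_digraph"
  assumes "\<forall>a\<in>arcs Q. \<not> tail Q a < head Q a" "set as \<subseteq> arcs Q" "pre_digraph.cas Q u as v"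
  shows "v \<le> u"
  using assms(2,3) assms(1)
proof (induction as arbitrary: u)
  case (Cons a as)
  then have "v \<le> head Q a" "tail Q a = u" "\<not> tail Q a < head Q a"
    by (auto simp: pre_digraph.cas.simps)
  then show ?case by simp
qed (simp add: pre_digraph.cas.simps)

text \<open>The vertices along a path decrease weakly, so on a closed path they are squeezed between
  \<open>u\<close> and \<open>u\<close>.\<close>

lemma cas_loops:
  fixes Q :: "('v::linorder, 'e) pre_digraph"
  assumes "\<forall>a\<in>arcs Q. \<not> tail Q a < head Q a" "set as \<subseteq> arcs Q" "pre_digraph.cas Q u as u"
  shows "\<forall>a\<in>set as. tail Q a = u \<and> head Q a = u"
  using assms(2,3)
proof (induction as)
  case (Cons a as)
  then have a: "a \<in> arcs Q" "tail Q a = u" "pre_digraph.cas Q (head Q a) as u" "set as \<subseteq> arcs Q"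
    by (auto simp: pre_digraph.cas.simps)
  then have "u \<le> head Q a" using cas_descending[OF assms(1)] by blast
  moreover have "head Q a \<le> u" using assms(1) a(1,2) by auto
  ultimately have "head Q a = u" by simp
  then show ?case using Cons a by simp
qed simp

text \<open>The combinatorial half, for the generated subalgebra itself before any conjugation.
  Every element of \<open>A\<close> is the image of a combination of paths, so triangularity and the
  shape of the diagonal corners are checked on single paths.\<close>

lemma bound_quiver_triangular_extension:
  fixes n :: nat
    and Q :: "(nat, 'e) pre_digraph"
    and I :: "((nat, 'e) qpath \<Rightarrow>\<^sub>0 'k::comm_ring_1) set"
    and A :: "((nat, 'e) qpath \<Rightarrow>\<^sub>0 'k) set ring"
    and R :: "(((nat, 'e) qpath \<Rightarrow>\<^sub>0 'k) set, ((nat, 'e) qpath \<Rightarrow>\<^sub>0 'k) set) pre_digraph"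
  assumes Q: "fin_digraph Q" and verts: "verts Q = {1..n}"
    and desc: "\<forall>a\<in>arcs Q. \<not> tail Q a < head Q a"
    and I: "ideal I (path_algebra Q)"
    and A: "A = path_algebra Q Quot I"
    and R: "verts R \<subseteq> carrier A" "arcs R \<subseteq> carrier A"
    and R_verts: "\<forall>x\<in>verts R. \<exists>S\<subseteq>verts Q. x = (\<Oplus>\<^bsub>A\<^esub>i\<in>S. bq_vertex Q I i)"
    and R_arcs: "\<forall>\<beta>\<in>arcs R. \<exists>e\<in>verts Q. \<exists>f\<in>verts Q.
           \<beta> = bq_vertex Q I f \<otimes>\<^bsub>A\<^esub> \<beta> \<otimes>\<^bsub>A\<^esub> bq_vertex Q I e"
    and R_loops: "\<forall>a\<in>arcs Q. tail Q a = head Q a \<longrightarrow> bq_arrow Q I a \<in> arcs R"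
  defines "C \<equiv> generated_subalgebra (bq_scalars Q I) A (verts R \<union> arcs R)"
  shows "triangular_extension A C {1..n} (bq_vertex Q I)"
proof -
  let ?P = "path_algebra Q :: ((nat, 'e) qpath \<Rightarrow>\<^sub>0 'k) ring"
  let ?X = "verts R \<union> arcs R"
  define J where "J = {1..n}"
  have J: "verts Q = J" "finite J" using verts by (simp_all add: J_def)
  define h where "h f = I +>\<^bsub>?P\<^esub> f" for f
  interpret Q: fin_digraph Q by (rule Q)
  interpret P: ring ?P by (rule ring_path_algebra[OF Q])
  interpret I: ideal I ?P by (rule I)
  have A_ring: "ring A" unfolding A by (rule I.quotient_is_ring)
  interpret A: ring A by (rule A_ring)
  have h_hom: "h \<in> ring_hom ?P A" unfolding h_def A by (rule I.rcos_ring_hom)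
  have h_closed: "h f \<in> carrier A" if "Poly_Mapping.keys f \<subseteq> qpaths Q" for f
    using ring_hom_closed[OF h_hom] that by simp
  have h_mult: "h (path_mult f g) = h f \<otimes>\<^bsub>A\<^esub> h g"
    if "Poly_Mapping.keys f \<subseteq> qpaths Q" "Poly_Mapping.keys g \<subseteq> qpaths Q" for f g
    using ring_hom_mult[OF h_hom, of f g] that by simp
  have h_add: "h (f + g) = h f \<oplus>\<^bsub>A\<^esub> h g"
    if "Poly_Mapping.keys f \<subseteq> qpaths Q" "Poly_Mapping.keys g \<subseteq> qpaths Q" for f g
    using ring_hom_add[OF h_hom, of f g] that by simp
  have h_zero: "h 0 = \<zero>\<^bsub>A\<^esub>"
    using ring_hom_zero[OF h_hom P.ring_axioms A_ring] by simp
  have h_one: "h (path_scalar Q 1) = \<one>\<^bsub>A\<^esub>"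
    using ring_hom_one[OF h_hom] by simp
  have h_onto: "\<exists>f. Poly_Mapping.keys f \<subseteq> qpaths Q \<and> a = h f" if "a \<in> carrier A" for a
    using that by (auto simp: A FactRing_def A_RCOSETS_def' h_def)
  define e where "e = bq_vertex Q I"
  have e_h: "e i = h (path_vertex i)" for i
    by (simp add: e_def bq_vertex_def h_def)
  have v_keys: "Poly_Mapping.keys (path_vertex i :: (nat, 'e) qpath \<Rightarrow>\<^sub>0 'k) \<subseteq> qpaths Q" if "i \<in> J" for i
    using that vertex_in_qpaths[of i Q] J by (simp add: path_vertex_def)
  have e_closed: "e i \<in> carrier A" if "i \<in> J" for i
    using h_closed[OF v_keys[OF that]] by (simp add: e_h)
  have e_mult: "e i \<otimes>\<^bsub>A\<^esub> e j = (if i = j then e i else \<zero>\<^bsub>A\<^esub>)" if "i \<in> J" "j \<in> J" for i j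
  proof -
    have "path_mult (path_vertex i) (path_vertex j) = (if i = j then path_vertex i else 0 :: (nat, 'e) qpath \<Rightarrow>\<^sub>0 'k)"
      by (simp add: path_vertex_def path_mult_single path_comp_def)
    then show ?thesis
      using h_mult[OF v_keys[OF that(1)] v_keys[OF that(2)]] h_zero by (simp add: e_h split: if_splits)
  qed
  have e_sum: "(\<Oplus>\<^bsub>A\<^esub>i\<in>J. e i) = \<one>\<^bsub>A\<^esub>"
  proof -
    have "h (finsum ?P path_vertex J) = (\<Oplus>\<^bsub>A\<^esub>i\<in>J. h (path_vertex i))"
      using h_hom v_keys
      by (intro hom_finsum[OF P.abelian_group_axioms A.abelian_group_axioms])
        (auto simp: hom_def ring_hom_def)
    moreover have "finsum ?P path_vertex J = path_scalar Q 1"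
      using v_keys by (subst path_algebra_finsum[OF _ Q]) (auto simp: path_scalar_def J path_vertex_def)
    ultimately show ?thesis by (simp add: e_h h_one)
  qed
  have sandwich: "e i \<otimes>\<^bsub>A\<^esub> h f \<otimes>\<^bsub>A\<^esub> e j = h (path_mult (path_mult (path_vertex i) f) (path_vertex j))"
    if "i \<in> J" "j \<in> J" "Poly_Mapping.keys f \<subseteq> qpaths Q" for i j f
    using that v_keys by (simp add: e_h h_mult keys_path_mult)
  have triangular: "e i \<otimes>\<^bsub>A\<^esub> a \<otimes>\<^bsub>A\<^esub> e j = \<zero>\<^bsub>A\<^esub>"
    if ij: "i \<in> J" "j \<in> J" "j < i" and a: "a \<in> carrier A" for i j a
  proof -
    obtain f where f: "Poly_Mapping.keys f \<subseteq> qpaths Q" "a = h f" using h_onto[OF a] by blast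
    have "path_mult (path_mult (path_vertex i) f) (path_vertex j) = 0"
      using f(1)
    proof (induction f rule: poly_mapping_single_induct)
      case (single p c)
      obtain u as v where p: "p = (u, as, v)" by (cases p)
      have "set as \<subseteq> arcs Q" "pre_digraph.cas Q u as v"
        using single p by (auto simp: qpaths_def pre_digraph.awalk_def)
      then have "v \<le> u" using cas_descending[OF desc] by blast
      then show ?case using ij by (auto simp: p path_vertex_sandwich)
    qed (simp_all add: path_mult_add_left path_mult_add_right)
    then show ?thesis using sandwich[OF ij(1,2) f(1)] f(2) h_zero by simp
  qed
  \<comment> \<open>Scalars are written as images under \<open>h\<close>, so that their centrality
    can be read off in the path algebra.\<close>
  have K_h: "bq_scalars Q I = {h (path_scalar Q c) | c. True}"
    by (simp add: bq_scalars_def h_def path_scalar_def)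
  have K: "bq_scalars Q I \<subseteq> carrier A"
    using h_closed path_scalar_keys by (auto simp: K_h)
  have K_central: "k \<otimes>\<^bsub>A\<^esub> a = a \<otimes>\<^bsub>A\<^esub> k" if k: "k \<in> bq_scalars Q I" and a: "a \<in> carrier A" for k a
  proof -
    obtain c where c: "k = h (path_scalar Q c)" using k unfolding K_h by blast
    obtain f where f: "Poly_Mapping.keys f \<subseteq> qpaths Q" "a = h f" using h_onto[OF a] by blast
    show ?thesis
      using path_scalar_central[OF Q f(1), of c] c f path_scalar_keys[of Q c]
      by (simp add: h_mult[symmetric])
  qed
  have X: "?X \<subseteq> carrier A" using R by blast
  have C: "unital_subalgebra (bq_scalars Q I) C A" and XC: "?X \<subseteq> C"
    unfolding C_def using generated_subalgebra_props[OF A_ring K X] by auto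
  then have C_sub: "subring C A"
    and C_smult: "\<And>k b. k \<in> bq_scalars Q I \<Longrightarrow> b \<in> C \<Longrightarrow> k \<otimes>\<^bsub>A\<^esub> b \<in> C"
    by (auto simp: unital_subalgebra_iff[OF A_ring])
  note CE = subringE[OF C_sub]
  have KC: "k \<in> C" if "k \<in> bq_scalars Q I" for k
    using C_smult[OF that CE(3)] K that by auto
  \<comment> \<open>A nontrivial closed path is a product of loops, and each loop is among the
    generators.\<close>
  have loops: "h (Poly_Mapping.single (u, as, u) 1) \<in> C"
    if "as \<noteq> []" "(u, as, u) \<in> qpaths Q" for u as
  proof -
    have as: "set as \<subseteq> arcs Q" "u \<in> verts Q" "\<forall>a\<in>set as. tail Q a = u \<and> head Q a = u"
      using that(2) cas_loops[OF desc] by (auto simp: qpaths_def pre_digraph.awalk_def)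
    show ?thesis
      using \<open>as \<noteq> []\<close> as(1,3)
    proof (induction as rule: list_nonempty_induct)
      case (single a)
      then have "h (Poly_Mapping.single (u, [a], u) 1) = bq_arrow Q I a"
        by (simp add: h_def bq_arrow_def path_arrow_def)
      then show ?case using R_loops XC single by auto
    next
      case (cons a as)
      have arc: "h (Poly_Mapping.single (u, [a], u) 1) = bq_arrow Q I a"
        using cons.prems by (simp add: h_def bq_arrow_def path_arrow_def)
      \<comment> \<open>Loops at one vertex compose in any number; the tail of the list is therefore
        again a closed path at \<open>u\<close>.\<close>
      have cas: "pre_digraph.cas Q u bs u" if "\<forall>b\<in>set bs. tail Q b = u \<and> head Q b = u" for bs
        using that by (induction bs) (auto simp: pre_digraph.cas.simps)
      have q: "(u, as, u) \<in> qpaths Q" "(u, [a], u) \<in> qpaths Q"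
        using cons.prems cas as(2) by (simp_all add: qpaths_def pre_digraph.awalk_def)
      \<comment> \<open>The first letter \<open>a\<close> is traversed first, hence it is the right
        factor.\<close>
      have "Poly_Mapping.single (u, a # as, u) 1 =
          path_mult (Poly_Mapping.single (u, as, u) 1) (Poly_Mapping.single (u, [a], u) (1 :: 'k))"
        by (simp add: path_mult_single path_comp_def)
      then have "h (Poly_Mapping.single (u, a # as, u) 1) =
          h (Poly_Mapping.single (u, as, u) 1) \<otimes>\<^bsub>A\<^esub> bq_arrow Q I a"
        using q by (simp add: h_mult arc[symmetric])
      moreover have "h (Poly_Mapping.single (u, as, u) 1) \<in> C"
        using cons.prems by (intro cons.IH) auto
      moreover have "a \<in> arcs Q" "tail Q a = head Q a" using cons.prems by auto
      then have "bq_arrow Q I a \<in> C" using R_loops XC by blast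
      ultimately show ?case using CE(6) by metis
    qed
  qed
  have diag: "\<exists>c\<in>bq_scalars Q I. \<exists>r\<in>C. e i \<otimes>\<^bsub>A\<^esub> a \<otimes>\<^bsub>A\<^esub> e i = c \<otimes>\<^bsub>A\<^esub> e i \<oplus>\<^bsub>A\<^esub> r"
    if i: "i \<in> J" and a: "a \<in> carrier A" for i a
  proof -
    let ?s = "\<lambda>f. path_mult (path_mult (path_vertex i) f) (path_vertex i)"
    obtain f where f: "Poly_Mapping.keys f \<subseteq> qpaths Q" "a = h f" using h_onto[OF a] by blast
    have "\<exists>c. \<exists>r\<in>C. h (?s f) = h (path_scalar Q c) \<otimes>\<^bsub>A\<^esub> e i \<oplus>\<^bsub>A\<^esub> r"
      using f(1)
    proof (induction f rule: poly_mapping_single_induct)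
      case zero
      have "h (path_scalar Q 0) = \<zero>\<^bsub>A\<^esub>" by (simp add: path_scalar_def h_zero)
      then show ?case
        using e_closed[OF i] CE(2) by (intro exI[of _ 0] bexI[of _ "\<zero>\<^bsub>A\<^esub>"]) (simp_all add: h_zero)
    next
      case (single p c)
      obtain u as v where p: "p = (u, as, v)" by (cases p)
      have h0: "h (path_scalar Q 0) = \<zero>\<^bsub>A\<^esub>" by (simp add: path_scalar_def h_zero)
      show ?case
      proof (cases "v = i \<and> u = i")
        case False
        then have "?s (Poly_Mapping.single p c) = 0" by (auto simp: p path_vertex_sandwich)
        then show ?thesis
          using h0 e_closed[OF i] CE(2) by (intro exI[of _ 0] bexI[of _ "\<zero>\<^bsub>A\<^esub>"]) (simp_all add: h_zero)
      next
        case True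
        have q: "(i, as, i) \<in> qpaths Q" using single p True by simp
        have s: "?s (Poly_Mapping.single p c) = path_mult (path_scalar Q c) (Poly_Mapping.single (i, as, i) 1)"
          using True path_scalar_mult_single(1)[OF Q q, of c 1] by (simp add: p path_vertex_sandwich)
        then have hs: "h (?s (Poly_Mapping.single p c)) = h (path_scalar Q c) \<otimes>\<^bsub>A\<^esub> h (Poly_Mapping.single (i, as, i) 1)"
          using q by (simp add: h_mult path_scalar_keys)
        show ?thesis
        \<comment> \<open>The trivial path supplies the scalar multiple of \<open>e i\<close>, with
          \<open>r = 0\<close>; a nontrivial closed path lies in \<open>C\<close> and supplies
          \<open>r\<close>, with scalar \<open>0\<close>.\<close>
        proof (cases "as = []")
          case True
          then have "h (Poly_Mapping.single (i, as, i) 1) = e i" by (simp add: e_h path_vertex_def)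
          then show ?thesis
            using hs e_closed[OF i] h_closed[OF path_scalar_keys] CE(2)
            by (intro exI[of _ c] bexI[of _ "\<zero>\<^bsub>A\<^esub>"]) simp_all
        next
          case False
          have "h (Poly_Mapping.single (i, as, i) 1) \<in> C" by (rule loops[OF False q])
          moreover have "h (path_scalar Q c) \<in> bq_scalars Q I" by (auto simp: K_h)
          ultimately have r: "h (?s (Poly_Mapping.single p c)) \<in> C" using hs C_smult by simp
          then have "h (?s (Poly_Mapping.single p c)) \<in> carrier A" using CE(1) by blast
          then show ?thesis
            using r h0 e_closed[OF i] by (intro exI[of _ 0] bexI[OF _ r]) simp
        qed
      qed
    next
      case (add f g)
      obtain c r where c: "r \<in> C" "h (?s f) = h (path_scalar Q c) \<otimes>\<^bsub>A\<^esub> e i \<oplus>\<^bsub>A\<^esub> r"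
        using add by blast
      obtain d t where d: "t \<in> C" "h (?s g) = h (path_scalar Q d) \<otimes>\<^bsub>A\<^esub> e i \<oplus>\<^bsub>A\<^esub> t"
        using add by blast
      have rt: "r \<in> carrier A" "t \<in> carrier A" using c d CE(1) by auto
      have sk: "h (path_scalar Q x) \<in> carrier A" for x by (rule h_closed[OF path_scalar_keys])
      have "h (?s (f + g)) = h (?s f) \<oplus>\<^bsub>A\<^esub> h (?s g)"
        using add(1,2) v_keys[OF i] by (simp add: path_mult_add_left path_mult_add_right h_add keys_path_mult)
      also have "\<dots> = h (path_scalar Q (c + d)) \<otimes>\<^bsub>A\<^esub> e i \<oplus>\<^bsub>A\<^esub> (r \<oplus>\<^bsub>A\<^esub> t)"
        using rt sk e_closed[OF i]
        by (simp add: c d path_scalar_add h_add path_scalar_keys A.l_distr A.a_assoc A.a_lcomm)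
      finally show ?case using CE(7)[OF c(1) d(1)] by blast
    qed
    then show ?thesis using sandwich[OF i i f(1)] f(2) by (auto simp: K_h)
  qed
  \<comment> \<open>Sums of vertices have no off-diagonal corners. An arrow of \<open>R\<close> sits
    in one corner, so any corner of it is either the arrow or zero.\<close>
  have off: "e i \<otimes>\<^bsub>A\<^esub> x \<otimes>\<^bsub>A\<^esub> e j \<in> C"
    if x: "x \<in> ?X" and ij: "i \<in> J" "j \<in> J" "i \<noteq> j" for x i j
  proof -
    consider "x \<in> verts R" | "x \<in> arcs R" using x by blast
    then show ?thesis
    proof cases
      case 1
      then obtain S where S: "S \<subseteq> J" "x = (\<Oplus>\<^bsub>A\<^esub>k\<in>S. e k)"
        using R_verts J by (auto simp: e_def)
      have fin: "finite S" using S(1) J(2) finite_subset by blast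
      have eS: "e \<in> S \<rightarrow> carrier A" using S(1) e_closed by blast
      have "e i \<otimes>\<^bsub>A\<^esub> x \<otimes>\<^bsub>A\<^esub> e j = (\<Oplus>\<^bsub>A\<^esub>k\<in>S. e i \<otimes>\<^bsub>A\<^esub> e k \<otimes>\<^bsub>A\<^esub> e j)"
        unfolding S(2) using fin eS e_closed[OF ij(1)] e_closed[OF ij(2)]
        by (simp add: A.finsum_rdistr A.finsum_ldistr Pi_iff)
      also have "\<dots> = (\<Oplus>\<^bsub>A\<^esub>k\<in>S. \<zero>\<^bsub>A\<^esub>)"
        using S(1) ij e_closed by (intro A.finsum_cong') (auto simp: e_mult subset_iff)
      finally show ?thesis using CE(2) by simp
    next
      case 2
      then obtain k l where kl: "k \<in> J" "l \<in> J" "x = e l \<otimes>\<^bsub>A\<^esub> x \<otimes>\<^bsub>A\<^esub> e k"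
        using R_arcs J unfolding e_def by metis
      have xA: "x \<in> carrier A" using x X by blast
      have cl: "e i \<in> carrier A" "e j \<in> carrier A" "e k \<in> carrier A" "e l \<in> carrier A"
        using e_closed ij kl by auto
      have "e i \<otimes>\<^bsub>A\<^esub> x \<otimes>\<^bsub>A\<^esub> e j = (e i \<otimes>\<^bsub>A\<^esub> e l) \<otimes>\<^bsub>A\<^esub> x \<otimes>\<^bsub>A\<^esub> (e k \<otimes>\<^bsub>A\<^esub> e j)"
        using cl xA by (subst kl(3)) (simp add: A.m_assoc)
      also have "\<dots> \<in> C"
      proof (cases "i = l \<and> k = j")
        case True
        then have "(e i \<otimes>\<^bsub>A\<^esub> e l) \<otimes>\<^bsub>A\<^esub> x \<otimes>\<^bsub>A\<^esub> (e k \<otimes>\<^bsub>A\<^esub> e j) = x"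
          using kl e_mult[of l l] e_mult[of k k] by simp
        then show ?thesis using x XC by auto
      next
        case False
        then show ?thesis using ij kl cl xA CE(2) by (auto simp: e_mult)
      qed
      finally show ?thesis .
    qed
  qed
  have idem: "e i \<otimes>\<^bsub>A\<^esub> e i = e i" if "i \<in> J" for i
    using e_mult[OF that that] by simp
  have orth: "e i \<otimes>\<^bsub>A\<^esub> e j = \<zero>\<^bsub>A\<^esub>" if "i \<in> J" "j \<in> J" "i \<noteq> j" for i j
    using e_mult[OF that(1,2)] that(3) by simp
  note off_diagonal = generated_subalgebra_off_diagonal[OF A_ring K K_central X J(2) e_closed idem orth e_sum
      diag[unfolded C_def] off[unfolded C_def], folded C_def]
  \<comment> \<open>The scalar from \<open>diag\<close> serves as \<open>c\<close>: scalars lie in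
    \<open>C\<close> because \<open>C\<close> contains the unit, and they commute with
    \<open>e i\<close>.\<close>
  have "\<exists>c\<in>C. \<exists>r\<in>C. c \<otimes>\<^bsub>A\<^esub> e i = e i \<otimes>\<^bsub>A\<^esub> c \<and> e i \<otimes>\<^bsub>A\<^esub> a \<otimes>\<^bsub>A\<^esub> e i = c \<otimes>\<^bsub>A\<^esub> e i \<oplus>\<^bsub>A\<^esub> r"
    if i: "i \<in> J" and a: "a \<in> carrier A" for i a
  proof -
    obtain c r where "c \<in> bq_scalars Q I" "r \<in> C" "e i \<otimes>\<^bsub>A\<^esub> a \<otimes>\<^bsub>A\<^esub> e i = c \<otimes>\<^bsub>A\<^esub> e i \<oplus>\<^bsub>A\<^esub> r"
      using diag[OF i a] by blast
    then show ?thesis using KC K_central e_closed[OF i] by blast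
  qed
  then have "triangular_extension A C J e"
    by (intro triangular_extension.intro triangular_extension_axioms.intro A_ring C_sub J(2)
        e_closed idem orth e_sum triangular off_diagonal)
  then show ?thesis by (simp add: e_def J_def)
qed

theorem corollary3p3:
  fixes n :: nat
    and Q :: "(nat, 'e) pre_digraph"
    and I :: "((nat, 'e) qpath \<Rightarrow>\<^sub>0 'k::alg_closed_field) set"
    and A :: "((nat, 'e) qpath \<Rightarrow>\<^sub>0 'k) set ring"
    and B C :: "((nat, 'e) qpath \<Rightarrow>\<^sub>0 'k) set set"
    and R :: "(((nat, 'e) qpath \<Rightarrow>\<^sub>0 'k) set, ((nat, 'e) qpath \<Rightarrow>\<^sub>0 'k) set) pre_digraph"
  assumes "n \<ge> 1"
    and "fin_digraph Q"
    and "verts Q = {1..n}"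
    and "\<forall>a\<in>arcs Q. \<not> tail Q a < head Q a"
    and "admissible_ideal Q I"
    and "A = path_algebra Q Quot I"
    and "wf_digraph R"
    and "verts R \<subseteq> carrier A"
    and "arcs R \<subseteq> carrier A"
    and "\<forall>\<beta>\<in>arcs R. \<beta> = head R \<beta> \<otimes>\<^bsub>A\<^esub> \<beta> \<otimes>\<^bsub>A\<^esub> tail R \<beta>"
    and "\<forall>x\<in>verts R. \<exists>S\<subseteq>verts Q. x = (\<Oplus>\<^bsub>A\<^esub>i\<in>S. bq_vertex Q I i)"
    and "\<forall>\<beta>\<in>arcs R. \<exists>e\<in>verts Q. \<exists>f\<in>verts Q.
           \<beta> = bq_vertex Q I f \<otimes>\<^bsub>A\<^esub> \<beta> \<otimes>\<^bsub>A\<^esub> bq_vertex Q I e"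
    and "\<forall>a\<in>arcs Q. tail Q a = head Q a \<longrightarrow> bq_arrow Q I a \<in> arcs R"
    and "C = generated_subalgebra (bq_scalars Q I) A (verts R \<union> arcs R)"
    and "unital_subalgebra (bq_scalars Q I) B A"
    and "conjugate_in A B C"
    and "infinite (UNIV :: 'u set)"
    and "\<exists>\<iota> :: ((nat, 'e) qpath \<Rightarrow>\<^sub>0 'k) set \<Rightarrow> 'u. inj_on \<iota> (carrier A)"
  shows "rel_gldim TYPE('u) A B \<le> enat (n - 1)"
proof -
  have I: "ideal I (path_algebra Q)" using assms(5) by (simp add: admissible_ideal_def)
  interpret C: triangular_extension A C "{1..n}" "bq_vertex Q I"
    unfolding assms(14)
    by (rule bound_quiver_triangular_extension[OF assms(2-4) I assms(6,8,9,11-13)])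
  obtain z where z: "z \<in> Units A" and C: "C = {z \<otimes>\<^bsub>A\<^esub> b \<otimes>\<^bsub>A\<^esub> inv\<^bsub>A\<^esub> z | b. b \<in> B}"
    using assms(16) unfolding conjugate_in_def by blast
  let ?\<gamma> = "\<lambda>x. inv\<^bsub>A\<^esub> z \<otimes>\<^bsub>A\<^esub> x \<otimes>\<^bsub>A\<^esub> z"
  have B: "subring B A" using assms(15) by (simp add: unital_subalgebra_def)
  have cancel_conj: "?\<gamma> (z \<otimes>\<^bsub>A\<^esub> b \<otimes>\<^bsub>A\<^esub> inv\<^bsub>A\<^esub> z) = b" if "b \<in> B" for b
    using subringE(1)[OF B] that by (intro C.A.conjugation_automorphism(3)[OF z]) auto
  have "C = (\<lambda>b. z \<otimes>\<^bsub>A\<^esub> b \<otimes>\<^bsub>A\<^esub> inv\<^bsub>A\<^esub> z) ` B" unfolding C by blast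
  \<comment> \<open>\<open>C\<close> is \<open>z B z\<inverse>\<close>, so the inverse conjugation
    carries it back onto \<open>B\<close>.\<close>
  then have \<gamma>C: "?\<gamma> ` C = B" using cancel_conj by (simp add: image_image)
  \<comment> \<open>For \<open>B\<close> the role of the vertices is played by their conjugates
    \<open>z\<inverse> e\<^sub>i z\<close>, with unchanged order of the indices.\<close>
  interpret B: triangular_extension A B "{1..n}" "\<lambda>i. ?\<gamma> (bq_vertex Q I i)"
    using C.image_automorphism[OF C.A.conjugation_automorphism(1,2)[OF z]] B unfolding \<gamma>C by blast
  obtain \<iota> :: "((nat, 'e) qpath \<Rightarrow>\<^sub>0 'k) set \<Rightarrow> 'u" where "inj_on \<iota> (carrier A)"
    using assms(18) by blast
  then show ?thesis
    using B.rel_gldim_le[OF assms(17)] assms(1) by blast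
qed

end
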